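(* Let $L$ be a virtual $n$-string link diagram and let $M(L)=(m_{ij})_{n\times n}$ be its bowling ball matrix (defined in the context), with entries in $\mathbb{Z}[s]/(s^2)$. Then: (1) every entry of $M(L)$ has the form $as+b$ with $a\in\mathbb{Z}$ and $b\in\{0,1\}$; (2) $M(L)$ is invariant under generalized Reidemeister moves, so it is an invariant of the virtual $n$-string link represented by $L$. Moreover, $M$ determines a representation of the monoid of virtual $n$-string links: if $L_1L_2$ denotes the virtual string link obtained by placing $L_1$ on top of $L_2$, then $M(L_1L_2)=M(L_1)M(L_2)$, and the trivial $n$-string link is sent to the identity matrix $I_n$.
   Context: A virtual $n$-string link diagram is a collection of $n$ oriented immersed strings in the strip $\mathbb{R}\times[0,1]$, the $i$-th string running from $(i,1)$ to $(\pi(i),0)$ for some permutation $\pi$ of $\{1,\dots,n\}$, whose double points are transverse crossings, each marked either as a real crossing (with over/under information) or as a virtual crossing. Virtual $n$-string links are equivalence classes of such diagrams under the generalized Reidemeister moves (the classical Reidemeister moves $\Omega_1,\Omega_2,\Omega_3$ on real crossings, their virtual analogues $\Omega_1',\Omega_2',\Omega_3'$ involving only virtual crossings, and the mixed move $\Omega_3^s$ in which a strand with two virtual crossings passes across a real crossing), together with planar isotopy fixing the endpoints; they form a monoid under stacking. Bowling ball matrix. A ball is placed at a top endpoint $(i,1)$ and travels along the diagram following the orientation. At a real crossing it always continues along its own strand (weight $1$). At a virtual crossing, rotate the picture so that both strands are oriented downward; one strand enters from the upper left, the other from the upper right. A ball arriving along the strand entering from the upper left jumps onto the other strand (and continues along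 it in its orientation) with weight $s$, and continues along its own strand with weight $1-s$; a ball arriving along the strand entering from the upper right jumps with weight $-s$ and continues with weight $1+s$. Here $s$ is a formal variable with $s^2=0$. A path is a route of the ball from a top endpoint to a bottom endpoint obtained by these choices; its weight is the product in $\mathbb{Z}[s]/(s^2)$ of the weights at all virtual crossings it passes. (Any path with at least two jumps has weight $0$, so only finitely many paths have nonzero weight.) The $(i,j)$ entry $m_{ij}$ of $M(L)$ is the sum of the weights of all paths from $(i,1)$ to $(j,0)$. *)

theory Defs
  imports Main "Jordan_Normal_Form.Matrix"
begin

text \<open>An element Dual b a stands for b + a s, where s is a formal variable with s^2 = 0.\<close>

datatype dnum = Dual (re: int) (ep: int)

instantiation dnum :: comm_ring_1
begin
definition zero_dnum_def: "0 = Dual 0 0"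
definition one_dnum_def: "1 = Dual 1 0"
definition plus_dnum_def: "x + y = Dual (re x + re y) (ep x + ep y)"
definition minus_dnum_def: "x - y = Dual (re x - re y) (ep x - ep y)"
definition uminus_dnum_def: "- x = Dual (- re x) (- ep x)"
definition times_dnum_def: "x * y = Dual (re x * re y) (re x * ep y + ep x * re y)"
instance
  by standard (auto simp: zero_dnum_def one_dnum_def plus_dnum_def minus_dnum_def
      uminus_dnum_def times_dnum_def dnum.expand algebra_simps)
end

definition svar :: dnum where "svar = Dual 0 1"

text \<open>A diagram is a word of elementary slices stacked from top to bottom.  Each horizontal
  level carries finitely many points, listed from left to right (0-based), each with an
  orientation: True = the string points downward there, False = upward.
  Slices:
   Cross c i: a crossing of the strand A (upper position i to lower position i+1) with the
     strand B (upper position i+1 to lower position i); c = Real True means A passes over B,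
     Real False means B passes over A, Virt means a virtual crossing.  The strands may have
     any orientation.
   Cup i: a local minimum joining upper positions i and i+1.
   Cap i d: a local maximum creating lower positions i, i+1 with orientations d, \<not>d.\<close>

datatype ctype = Real bool | Virt
datatype gen = Cross ctype nat | Cup nat | Cap nat bool

fun gen_ok :: "gen \<Rightarrow> bool list \<Rightarrow> bool" where
  "gen_ok (Cross c i) w = (Suc i < length w)"
| "gen_ok (Cup i) w = (Suc i < length w \<and> w ! i \<noteq> w ! Suc i)"
| "gen_ok (Cap i d) w = (i \<le> length w)"

fun gen_out :: "gen \<Rightarrow> bool list \<Rightarrow> bool list" where
  "gen_out (Cross c i) w = w[i := w ! Suc i, Suc i := w ! i]"
| "gen_out (Cup i) w = take i w @ drop (Suc (Suc i)) w"
| "gen_out (Cap i d) w = take i w @ [d, \<not> d] @ drop i w"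

fun wf_word :: "bool list \<Rightarrow> gen list \<Rightarrow> bool" where
  "wf_word w [] = True"
| "wf_word w (g # gs) = (gen_ok g w \<and> wf_word (gen_out g w) gs)"

text \<open>Orientation list at level k (level 0 = top, level length D = bottom).\<close>
definition lev :: "nat \<Rightarrow> gen list \<Rightarrow> nat \<Rightarrow> bool list" where
  "lev n D k = foldl (\<lambda>w g. gen_out g w) (replicate n True) (take k D)"

text \<open>Exits of a slice: Up q = leaves through the upper boundary at position q (moving up);
  Dn q = leaves through the lower boundary at position q (moving down).\<close>
datatype ex = Up nat | Dn nat

definition exitA :: "bool list \<Rightarrow> nat \<Rightarrow> ex" where
  "exitA w i = (if w ! i then Dn (Suc i) else Up i)"
definition exitB :: "bool list \<Rightarrow> nat \<Rightarrow> ex" where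
  "exitB w i = (if w ! Suc i then Dn i else Up (Suc i))"

text \<open>Ball entering slice g (upper orientation list w) from the top (fromtop = True) or from the
  bottom (fromtop = False) at position p: list of (weight, exit).  At a virtual crossing the picture
  is rotated so both strands point down; the strand then entering from the upper left is A iff
  A and B have the same orientation, otherwise it is B.\<close>
fun slice_step :: "gen \<Rightarrow> bool list \<Rightarrow> bool \<Rightarrow> nat \<Rightarrow> (dnum \<times> ex) list" where
  "slice_step (Cross c i) w fromtop p =
     (let onA = (if fromtop then p = i else p = Suc i);
          onB = (if fromtop then p = Suc i else p = i)
      in if onA \<or> onB then
           (let own = (if onA then exitA w i else exitB w i);
                oth = (if onA then exitB w i else exitA w i);
                upleft = (if w ! i = w ! Suc i then onA else onB)
            in (case c of
                  Real _ \<Rightarrow> [(1, own)]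
                | Virt \<Rightarrow> (if upleft then [(svar, oth), (1 - svar, own)]
                                  else [(- svar, oth), (1 + svar, own)])))
         else [(1, if fromtop then Dn p else Up p)])"
| "slice_step (Cup i) w fromtop p =
     (if fromtop then
        (if p = i then [(1, Up (Suc i))] else if p = Suc i then [(1, Up i)]
         else if p < i then [(1, Dn p)] else [(1, Dn (p - 2))])
      else (if p < i then [(1, Up p)] else [(1, Up (p + 2))]))"
| "slice_step (Cap i d) w fromtop p =
     (if fromtop then (if p < i then [(1, Dn p)] else [(1, Dn (p + 2))])
      else (if p = i then [(1, Dn (Suc i))] else if p = Suc i then [(1, Dn i)]
            else if p < i then [(1, Up p)] else [(1, Up (p - 2))]))"

type_synonym point = "nat \<times> nat"  \<comment> \<open>(level, position)\<close>

fun glob :: "nat \<Rightarrow> ex \<Rightarrow> point" where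
  "glob k (Up q) = (k, q)"
| "glob k (Dn q) = (Suc k, q)"

definition trans :: "nat \<Rightarrow> gen list \<Rightarrow> point \<Rightarrow> (dnum \<times> point) list" where
  "trans n D x = (case x of (k, p) \<Rightarrow>
     if p < length (lev n D k) then
       (if lev n D k ! p then
          (if k < length D then map (\<lambda>(a, e). (a, glob k e)) (slice_step (D ! k) (lev n D k) True p)
           else [])
        else
          (if 0 < k then map (\<lambda>(a, e). (a, glob (k - 1) e))
                            (slice_step (D ! (k - 1)) (lev n D (k - 1)) False p)
           else []))
     else [])"

definition cont :: "nat \<Rightarrow> gen list \<Rightarrow> point \<Rightarrow> point \<Rightarrow> bool" where
  "cont n D x y = (trans n D x \<noteq> [] \<and> y = snd (last (trans n D x)))"

text \<open>A valid virtual n-string link diagram: orientation-consistent, n downward endpoints at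
  the fromtop and at the bottom, and no closed components (every point of the diagram lies on a
  string starting at a fromtop endpoint).\<close>
definition valid :: "nat \<Rightarrow> gen list \<Rightarrow> bool" where
  "valid n D = (wf_word (replicate n True) D \<and> lev n D (length D) = replicate n True \<and>
     (\<forall>k \<le> length D. \<forall>p < length (lev n D k). \<exists>i < n. (cont n D)\<^sup>*\<^sup>* (0, i) (k, p)))"

definition tw :: "nat \<Rightarrow> gen list \<Rightarrow> point \<Rightarrow> point \<Rightarrow> dnum" where
  "tw n D x y = sum_list (map fst (filter (\<lambda>(a, z). z = y) (trans n D x)))"

definition is_path :: "nat \<Rightarrow> gen list \<Rightarrow> nat \<Rightarrow> nat \<Rightarrow> point list \<Rightarrow> bool" where
  "is_path n D i j xs = (xs \<noteq> [] \<and> hd xs = (0, i) \<and> last xs = (length D, j) \<and>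
     (\<forall>m. Suc m < length xs \<longrightarrow> xs ! Suc m \<in> snd ` set (trans n D (xs ! m))))"

definition path_weight :: "nat \<Rightarrow> gen list \<Rightarrow> point list \<Rightarrow> dnum" where
  "path_weight n D xs = (\<Prod>m < length xs - 1. tw n D (xs ! m) (xs ! Suc m))"

definition bb_entry :: "nat \<Rightarrow> gen list \<Rightarrow> nat \<Rightarrow> nat \<Rightarrow> dnum" where
  "bb_entry n D i j =
     (\<Sum>xs \<in> {xs. is_path n D i j xs \<and> path_weight n D xs \<noteq> 0}. path_weight n D xs)"

definition bb_matrix :: "nat \<Rightarrow> gen list \<Rightarrow> dnum mat" where
  "bb_matrix n D = mat n n (\<lambda>(i, j). bb_entry n D i j)"

fun gpos :: "gen \<Rightarrow> nat" where
  "gpos (Cross c i) = i" | "gpos (Cup i) = i" | "gpos (Cap i d) = i"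
fun inw :: "gen \<Rightarrow> nat" where
  "inw (Cross c i) = 2" | "inw (Cup i) = 2" | "inw (Cap i d) = 0"
fun outw :: "gen \<Rightarrow> nat" where
  "outw (Cross c i) = 2" | "outw (Cup i) = 0" | "outw (Cap i d) = 2"
fun setpos :: "gen \<Rightarrow> nat \<Rightarrow> gen" where
  "setpos (Cross c i) k = Cross c k" | "setpos (Cup i) k = Cup k" | "setpos (Cap i d) k = Cap k d"

fun flip :: "ctype \<Rightarrow> ctype" where
  "flip (Real b) = Real (\<not> b)" | "flip Virt = Virt"

fun is_real :: "ctype \<Rightarrow> bool" where
  "is_real (Real b) = True" | "is_real Virt = False"

text \<open>Admissible crossing data for a third move on strands p, q, r (left to right):
  a = crossing of (p,q), b = of (p,r), c = of (q,r).  Allowed: all real with a consistent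
  (acyclic) over/under order (Omega3), all virtual (Omega3'), exactly one real (Omega3^s).\<close>
definition r3ok :: "ctype \<Rightarrow> ctype \<Rightarrow> ctype \<Rightarrow> bool" where
  "r3ok a b c =
     ((a = Virt \<and> b = Virt \<and> c = Virt) \<or>
      (card {x \<in> {0::nat, 1, 2}. is_real ([a, b, c] ! x)} = 1) \<or>
      (is_real a \<and> is_real b \<and> is_real c \<and>
       \<not> (a = Real True \<and> c = Real True \<and> b = Real False) \<and>
       \<not> (a = Real False \<and> c = Real False \<and> b = Real True)))"

text \<open>Local relations: planar isotopy of Morse diagrams (level exchange, cancellation of
  critical points, sliding crossings past critical points) and generalized Reidemeister moves.\<close>
inductive lrel :: "gen list \<Rightarrow> gen list \<Rightarrow> bool" where
  far_comm: "gpos g + outw g \<le> gpos h \<Longrightarrow>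
     lrel [g, h] [setpos h (gpos h + inw g - outw g), g]"
| zigzag1: "lrel [Cap (Suc i) d, Cup i] []"
| zigzag2: "lrel [Cap i d, Cup (Suc i)] []"
| slide_cap: "lrel [Cap i d, Cross c (Suc i)] [Cap (Suc i) d, Cross (flip c) i]"
| slide_cup: "lrel [Cross c (Suc i), Cup i] [Cross (flip c) i, Cup (Suc i)]"
| omega1_r: "lrel [Cap (Suc i) d, Cross c i, Cup (Suc i)] []"
| omega1_l: "lrel [Cap i d, Cross c (Suc i), Cup i] []"
| omega2: "lrel [Cross (Real b) i, Cross (Real (\<not> b)) i] []"
| omega2v: "lrel [Cross Virt i, Cross Virt i] []"
| omega3: "r3ok a b c \<Longrightarrow>
     lrel [Cross a i, Cross b (Suc i), Cross c i] [Cross c (Suc i), Cross b i, Cross a (Suc i)]"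

definition rmove :: "nat \<Rightarrow> gen list \<Rightarrow> gen list \<Rightarrow> bool" where
  "rmove n D D' = (valid n D \<and> valid n D' \<and>
     (\<exists>p q U V. D = p @ U @ q \<and> D' = p @ V @ q \<and> (lrel U V \<or> lrel V U)))"

definition vsl_equiv :: "nat \<Rightarrow> gen list \<Rightarrow> gen list \<Rightarrow> bool" where
  "vsl_equiv n D D' = (valid n D \<and> (rmove n)\<^sup>*\<^sup>* D D')"

end

(* Fix a bottom endpoint j and let h(x) be the total weight of the paths from the point x of the
   diagram to j.  Then h is harmonic: its value at a point is the weighted average of its values
   at the possible next points, and column j of M(L) is h at the top endpoints.  On each slice
   harmonicity is a linear relation between the values of h on the upper and on the lower
   boundary, so it can be transported through a local move: for both sides of every relation the
   composed relations coincide.  Since there are no closed components, following strings is an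
   acyclic dynamics; as s^2 = 0 allows one jump only, paths of nonzero weight have bounded length,
   and a harmonic function is determined by its bottom values (first the constant terms, then the
   coefficients of s).  Hence the bottom values e_j determine the column, which gives invariance;
   linearity of the slice relations gives multiplicativity.  The constant term of h is constant
   along strings, hence 0 or 1. *)

theory Submission
  imports Defs
begin

section \<open>The slice relations and their behaviour under local moves\<close>

lemma dnum_eq_iff: "x = y \<longleftrightarrow> re x = re y \<and> ep x = ep y"
  by (cases x; cases y) simp

lemma dnum_components [simp]:
  "re 0 = 0" "ep 0 = 0" "re 1 = 1" "ep 1 = 0" "re svar = 0" "ep svar = 1"
  "re (x + y) = re x + re y" "ep (x + y) = ep x + ep y"
  "re (x - y) = re x - re y" "ep (x - y) = ep x - ep y"
  "re (- x) = - re x" "ep (- x) = - ep x"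
  "re (x * y) = re x * re y" "ep (x * y) = re x * ep y + ep x * re y"
  by (simp_all add: zero_dnum_def one_dnum_def plus_dnum_def minus_dnum_def
      uminus_dnum_def times_dnum_def svar_def)

text \<open>Read from top to bottom, a virtual crossing of the strands A, B with values x, y acts on harmonic
  functions by a bijection in every orientation: A leaves with x - vw d (y - x) and B with
  y - vw d (y - x), where d is the orientation of the other strand.\<close>

fun vw :: "ctype \<Rightarrow> bool \<Rightarrow> dnum" where
  "vw (Real b) d = 0"
| "vw Virt d = (if d then svar else - svar)"

lemma re_vw [simp]: "re (vw c d) = 0"
  by (cases c) auto

lemma vw_flip [simp]: "vw (flip c) d = vw c d"
  by (cases c) auto

lemma ep_vw_not [simp]: "ep (vw c (\<not> d)) = - ep (vw c d)"
  by (cases c) auto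

section \<open>Deleting, inserting and overwriting a neighbouring pair in a sequence\<close>

definition del2 :: "nat \<Rightarrow> (nat \<Rightarrow> 'a) \<Rightarrow> nat \<Rightarrow> 'a" where
  "del2 i f p = (if p < i then f p else f (p + 2))"

definition ins2 :: "nat \<Rightarrow> 'a \<Rightarrow> 'a \<Rightarrow> (nat \<Rightarrow> 'a) \<Rightarrow> nat \<Rightarrow> 'a" where
  "ins2 i x y f p = (if p < i then f p else if p = i then x else if p = Suc i then y else f (p - 2))"

definition upd2 :: "nat \<Rightarrow> 'a \<Rightarrow> 'a \<Rightarrow> (nat \<Rightarrow> 'a) \<Rightarrow> nat \<Rightarrow> 'a" where
  "upd2 i x y f = f(i := x, Suc i := y)"

lemma upd2_upd2: "i \<le> j \<Longrightarrow> upd2 (Suc (Suc j)) a b (upd2 i x y f) = upd2 i x y (upd2 (Suc (Suc j)) a b f)"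
  by (auto simp: upd2_def fun_eq_iff)

lemma del2_upd2:
  "i \<le> j \<Longrightarrow> del2 (Suc (Suc j)) (upd2 i x y f) = upd2 i x y (del2 (Suc (Suc j)) f)"
  "i \<le> j \<Longrightarrow> del2 i (upd2 (Suc (Suc j)) x y f) = upd2 j x y (del2 i f)"
  by (auto simp: upd2_def del2_def fun_eq_iff)

lemma ins2_upd2:
  "i \<le> j \<Longrightarrow> ins2 (Suc (Suc j)) a b (upd2 i x y f) = upd2 i x y (ins2 (Suc (Suc j)) a b f)"
  "i \<le> j \<Longrightarrow> ins2 i a b (upd2 j x y f) = upd2 (Suc (Suc j)) x y (ins2 i a b f)"
  by (auto simp: upd2_def ins2_def fun_eq_iff)

lemma upd2_apply:
  "p < i \<Longrightarrow> upd2 i x y f p = f p" "upd2 i x y f i = x" "upd2 i x y f (Suc i) = y"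
  "Suc i < p \<Longrightarrow> upd2 i x y f p = f p"
  by (auto simp: upd2_def)

lemma del2_del2: "i \<le> j \<Longrightarrow> del2 i (del2 (Suc (Suc j)) f) = del2 j (del2 i f)"
  by (auto simp: del2_def fun_eq_iff)

text \<open>Positions are split relative to the pair \<open>i\<close>, \<open>Suc i\<close>; beyond
  it they are written \<open>Suc (Suc q)\<close>, so that the shift by two in \<open>del2\<close>
  and \<open>ins2\<close> cancels by simplification.\<close>

lemma position_cases:
  fixes p i :: nat
  obtains "p < i" | "p = i" | "p = Suc i" | q where "p = Suc (Suc q)" "i \<le> q"
proof -
  consider "p < i" | "p = i" | "p = Suc i" | "i + 2 \<le> p" by linarith
  then show ?thesis
  proof cases
    case 4
    then have "p = Suc (Suc (p - 2))" "i \<le> p - 2" by simp_all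
    then show ?thesis using that by blast
  qed (use that in blast)+
qed

lemma ins2_ins2:
  assumes "i \<le> j"
  shows "ins2 (Suc (Suc j)) a b (ins2 i x y f) = ins2 i x y (ins2 j a b f)"
proof
  fix p
  show "ins2 (Suc (Suc j)) a b (ins2 i x y f) p = ins2 i x y (ins2 j a b f) p"
    using assms by (cases rule: position_cases[of p i]) (auto simp: ins2_def)
qed

lemma del2_ins2_less:
  assumes "i \<le> j"
  shows "del2 i (ins2 (Suc (Suc j)) a b f) = ins2 j a b (del2 i f)"
proof
  fix p
  show "del2 i (ins2 (Suc (Suc j)) a b f) p = ins2 j a b (del2 i f) p"
    using assms by (cases rule: position_cases[of p j]) (auto simp: del2_def ins2_def)
qed

lemma del2_ins2_greater:
  assumes "i \<le> j"
  shows "del2 (Suc (Suc j)) (ins2 i a b f) = ins2 i a b (del2 j f)"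
proof
  fix p
  show "del2 (Suc (Suc j)) (ins2 i a b f) p = ins2 i a b (del2 j f) p"
    using assms by (cases rule: position_cases[of p i]) (auto simp: del2_def ins2_def)
qed

lemma del2_apply: "p < i \<Longrightarrow> del2 i f p = f p" "i \<le> p \<Longrightarrow> del2 i f p = f (Suc (Suc p))"
  by (auto simp: del2_def)

lemma ins2_apply: "p < i \<Longrightarrow> ins2 i x y f p = f p" "ins2 i x y f i = x"
  "ins2 i x y f (Suc i) = y" "i \<le> p \<Longrightarrow> ins2 i x y f (Suc (Suc p)) = f p"
  by (auto simp: ins2_def)

lemmas ins2_del2_simps = upd2_upd2 del2_upd2 ins2_upd2 upd2_apply del2_del2 ins2_ins2 del2_ins2_less del2_ins2_greater
  del2_apply ins2_apply

section \<open>The linear relation that a slice imposes on the values on its two boundaries\<close>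

definition crossf :: "dnum \<Rightarrow> dnum \<Rightarrow> nat \<Rightarrow> (nat \<Rightarrow> dnum) \<Rightarrow> nat \<Rightarrow> dnum" where
  "crossf u v i f = upd2 i (f (Suc i) - u * (f (Suc i) - f i)) (f i - v * (f (Suc i) - f i)) f"

text \<open>A relation and not a map: a cup restricts the upper values, and a cap creates a value
  that stays free until slices further down determine it.\<close>

fun tstep :: "bool list \<Rightarrow> gen \<Rightarrow> (nat \<Rightarrow> dnum) \<Rightarrow> (nat \<Rightarrow> dnum) \<Rightarrow> bool" where
  "tstep w (Cross c i) f f' = (f' = crossf (vw c (w ! i)) (vw c (w ! Suc i)) i f)"
| "tstep w (Cup i) f f' = (f i = f (Suc i) \<and> f' = del2 i f)"
| "tstep w (Cap i d) f f' = (\<exists>x. f' = ins2 i x x f)"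

fun run :: "bool list \<Rightarrow> gen list \<Rightarrow> (nat \<Rightarrow> dnum) \<Rightarrow> (nat \<Rightarrow> dnum) \<Rightarrow> bool" where
  "run w [] f f' = (f = f')"
| "run w (g # gs) f f' = (\<exists>f1. tstep w g f f1 \<and> run (gen_out g w) gs f1 f')"

abbreviation outs :: "bool list \<Rightarrow> gen list \<Rightarrow> bool list" where
  "outs \<equiv> foldl (\<lambda>w g. gen_out g w)"

lemma run_append:
  "run w (D @ E) f f' \<longleftrightarrow> (\<exists>f1. run w D f f1 \<and> run (outs w D) E f1 f')"
  by (induction D arbitrary: w f) auto

lemma wf_append: "wf_word w (D @ E) \<longleftrightarrow> wf_word w D \<and> wf_word (outs w D) E"
  by (induction D arbitrary: w) auto

text \<open>Words and value functions are transformed by the same three operations, so one set of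
  commutation rules serves both \<open>outs\<close> and \<open>run\<close>. The equations also hold
  at out-of-range indices, so they can be used as equations between functions.\<close>

lemma nth_gen_out [simp]:
  "Suc i < length w \<Longrightarrow> (!) (gen_out (Cross c i) w) = upd2 i (w ! Suc i) (w ! i) ((!) w)"
  "Suc i < length w \<Longrightarrow> (!) (gen_out (Cup i) w) = del2 i ((!) w)"
  "i \<le> length w \<Longrightarrow> (!) (gen_out (Cap i d) w) = ins2 i d (\<not> d) ((!) w)"
  by (auto simp: fun_eq_iff upd2_def del2_def ins2_def nth_append nth_Cons' numeral_2_eq_2
      nth_list_update Suc_diff_Suc)

lemma length_gen_out [simp]:
  "length (gen_out (Cross c i) w) = length w"
  "Suc i < length w \<Longrightarrow> length (gen_out (Cup i) w) = length w - 2"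
  "i \<le> length w \<Longrightarrow> length (gen_out (Cap i d) w) = length w + 2"
  by auto

declare gen_out.simps [simp del]

lemma list_eq_nthI: "length xs = length ys \<Longrightarrow> (!) xs = (!) ys \<Longrightarrow> xs = ys"
  by (auto intro: nth_equalityI)

section \<open>The two sides of each local relation: orientation words and composed linear
  relations\<close>

lemma outs_far_comm:
  assumes "gpos g + outw g \<le> gpos h" "wf_word w [g, h]"
    "wf_word w [setpos h (gpos h + inw g - outw g), g]"
  shows "outs w [g, h] = outs w [setpos h (gpos h + inw g - outw g), g]"
proof -
  obtain k where k: "gpos h = gpos g + outw g + k"
    using assms(1) le_Suc_ex by blast
  show ?thesis
    using assms(2-) k
    by (intro list_eq_nthI; cases g; cases h) (auto simp: ins2_del2_simps)
qed

lemma run_far_comm: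
  assumes "gpos g + outw g \<le> gpos h" "wf_word w [g, h]"
    "wf_word w [setpos h (gpos h + inw g - outw g), g]"
  shows "run w [g, h] f f' = run w [setpos h (gpos h + inw g - outw g), g] f f'"
proof -
  obtain k where k: "gpos h = gpos g + outw g + k"
    using assms(1) le_Suc_ex by blast
  show ?thesis
  \<comment> \<open>Two caps create two free values, whose existential witnesses have to be
    exchanged; the other pairs of slices need only the commutation rules.\<close>
  proof (cases "\<exists>i d j d'. g = Cap i d \<and> h = Cap j d'")
    case True
    then obtain i d j d' where "g = Cap i d" "h = Cap j d'" by blast
    then show ?thesis
      using k by (simp; metis ins2_ins2 le_add1)
  next
    case False
    then show ?thesis
      using assms(2-) k by (cases g; cases h) (auto simp: crossf_def ins2_del2_simps)
  qed
qed

lemma outs_zigzag1: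
  assumes "wf_word w [Cap (Suc i) d, Cup i]"
  shows "outs w [Cap (Suc i) d, Cup i] = w"
proof (intro list_eq_nthI ext)
  fix p
  show "outs w [Cap (Suc i) d, Cup i] ! p = w ! p"
    using assms by (cases rule: position_cases[of p i]) (auto simp: del2_def ins2_def less_Suc_eq)
qed (use assms in auto)

lemma outs_zigzag2:
  assumes "wf_word w [Cap i d, Cup (Suc i)]"
  shows "outs w [Cap i d, Cup (Suc i)] = w"
proof (intro list_eq_nthI ext)
  fix p
  show "outs w [Cap i d, Cup (Suc i)] ! p = w ! p"
    using assms by (cases rule: position_cases[of p i]) (auto simp: del2_def ins2_def less_Suc_eq)
qed (use assms in auto)

text \<open>The cup equates the free value of the cap with the value \<open>f i\<close> of the
  strand, so the strand passes through unchanged.\<close>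

lemma run_zigzag1: "run w [Cap (Suc i) d, Cup i] f f' \<longleftrightarrow> f = f'"
proof -
  have "del2 i (ins2 (Suc i) (f i) (f i) f) = f"
    by (auto simp: fun_eq_iff del2_def ins2_def less_Suc_eq)
  then show ?thesis by (auto simp: ins2_apply)
qed

lemma run_zigzag2: "run w [Cap i d, Cup (Suc i)] f f' \<longleftrightarrow> f = f'"
proof -
  have "del2 (Suc i) (ins2 i (f i) (f i) f) = f"
    by (auto simp: fun_eq_iff del2_def ins2_def less_Suc_eq)
  then show ?thesis by (auto simp: ins2_apply)
qed

lemma outs_slide_cap:
  assumes "wf_word w [Cap i d, Cross c (Suc i)]" "wf_word w [Cap (Suc i) d, Cross c' i]"
  shows "outs w [Cap i d, Cross c (Suc i)] = outs w [Cap (Suc i) d, Cross c' i]"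
proof (intro list_eq_nthI ext)
  fix p
  show "outs w [Cap i d, Cross c (Suc i)] ! p = outs w [Cap (Suc i) d, Cross c' i] ! p"
    using assms by (cases rule: position_cases[of p i]) (auto simp: ins2_def upd2_def)
qed (use assms in auto)

text \<open>The strand crosses one leg of the maximum or the other. The legs have opposite
  orientations, so the sign of the weight flips together with the roles of the two strands at the
  crossing.\<close>

lemma run_slide_cap:
  assumes "wf_word w [Cap i d, Cross c (Suc i)]" "wf_word w [Cap (Suc i) d, Cross c' i]"
    and [simp]: "\<And>e. vw c' e = vw c e"
  shows "run w [Cap i d, Cross c (Suc i)] f f' \<longleftrightarrow> run w [Cap (Suc i) d, Cross c' i] f f'"
proof -
  define u v where "u = vw c d" and "v = vw c (w ! i)"
  have uv: "vw c (\<not> d) = - u" "re u = 0" "re v = 0" by (auto simp: u_def v_def dnum_eq_iff)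
  \<comment> \<open>\<open>x\<close> and \<open>y\<close> are the cap values on the two sides. The
    leg ending at position \<open>i\<close> is crossed only on the right-hand side, which forces
    \<open>x\<close> to be \<open>y\<close> shifted with weight \<open>v\<close>.\<close>
  have ext: "crossf (- u) v (Suc i) (ins2 i x x f) = crossf v u i (ins2 (Suc i) y y f)"
    if "x = y - v * (y - f i)" for x y
  proof
    fix p
    show "crossf (- u) v (Suc i) (ins2 i x x f) p = crossf v u i (ins2 (Suc i) y y f) p"
      using uv that by (cases rule: position_cases[of p i])
       (auto simp: crossf_def upd2_def ins2_def dnum_eq_iff algebra_simps)
  qed
  \<comment> \<open>As \<open>v\<close> has square 0, the shift is invertible, so the two
    existential quantifiers describe the same functions.\<close>
  have inv: "x = (x + v * (x - f i)) - v * ((x + v * (x - f i)) - f i)" for x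
    using uv by (auto simp: dnum_eq_iff algebra_simps)
  have "run w [Cap i d, Cross c (Suc i)] f f' \<longleftrightarrow> (\<exists>x. f' = crossf (- u) v (Suc i) (ins2 i x x f))"
    using assms(1,2) uv by (auto simp: ins2_apply u_def v_def)
  also have "\<dots> \<longleftrightarrow> (\<exists>y. f' = crossf v u i (ins2 (Suc i) y y f))"
    using ext inv by metis
  also have "\<dots> \<longleftrightarrow> run w [Cap (Suc i) d, Cross c' i] f f'"
    using assms(1,2) by (auto simp: ins2_apply u_def v_def)
  finally show ?thesis .
qed

lemma outs_slide_cup:
  assumes "wf_word w [Cross c (Suc i), Cup i]" "wf_word w [Cross c' i, Cup (Suc i)]"
  shows "outs w [Cross c (Suc i), Cup i] = outs w [Cross c' i, Cup (Suc i)]"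
proof (intro list_eq_nthI ext)
  fix p
  show "outs w [Cross c (Suc i), Cup i] ! p = outs w [Cross c' i, Cup (Suc i)] ! p"
    using assms by (cases rule: position_cases[of p i]) (auto simp: del2_def upd2_def)
qed (use assms in auto)

lemma run_slide_cup:
  assumes "wf_word w [Cross c (Suc i), Cup i]" "wf_word w [Cross c' i, Cup (Suc i)]"
    and [simp]: "\<And>e. vw c' e = vw c e"
  shows "run w [Cross c (Suc i), Cup i] f f' \<longleftrightarrow> run w [Cross c' i, Cup (Suc i)] f f'"
proof -
  define u v where "u = vw c (w ! i)" and "v = vw c (w ! Suc i)"
  \<comment> \<open>The cup closes the strands that start at positions \<open>i\<close> and
    \<open>Suc (Suc i)\<close>; its side condition makes them opposite.\<close>
  have w: "w ! Suc (Suc i) = (\<not> w ! i)"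
    using assms(1) by (auto simp: upd2_def)
  have uv: "vw c (w ! Suc (Suc i)) = - u" "re u = 0" "re v = 0"
    unfolding w by (auto simp: u_def v_def dnum_eq_iff)
  let ?g = "crossf v (- u) (Suc i) f" and ?h = "crossf u v i f"
  have iff: "?g i = ?g (Suc i) \<longleftrightarrow> ?h (Suc i) = ?h (Suc (Suc i))"
    using uv by (auto simp: crossf_def upd2_def dnum_eq_iff algebra_simps)
  \<comment> \<open>The passing strand is shifted by its difference to one leg or to the other;
    under the cup equation the legs have equal constant terms.\<close>
  have eq: "del2 i ?g = del2 (Suc i) ?h" if "?g i = ?g (Suc i)"
  proof
    fix p
    show "del2 i ?g p = del2 (Suc i) ?h p"
      using uv that by (cases rule: position_cases[of p i])
       (auto simp: crossf_def upd2_def del2_def dnum_eq_iff algebra_simps)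
  qed
  have "run w [Cross c (Suc i), Cup i] f f' \<longleftrightarrow> ?g i = ?g (Suc i) \<and> f' = del2 i ?g"
    using uv by (auto simp: u_def v_def)
  also have "\<dots> \<longleftrightarrow> ?h (Suc i) = ?h (Suc (Suc i)) \<and> f' = del2 (Suc i) ?h"
    using iff eq by auto
  also have "\<dots> \<longleftrightarrow> run w [Cross c' i, Cup (Suc i)] f f'"
    by (auto simp: u_def v_def)
  finally show ?thesis .
qed

lemma outs_omega1_r:
  assumes "wf_word w [Cap (Suc i) d, Cross c i, Cup (Suc i)]"
  shows "outs w [Cap (Suc i) d, Cross c i, Cup (Suc i)] = w"
proof (intro list_eq_nthI ext)
  fix p
  show "outs w [Cap (Suc i) d, Cross c i, Cup (Suc i)] ! p = w ! p"
    using assms by (cases rule: position_cases[of p i]) (auto simp: upd2_def del2_def ins2_def less_Suc_eq)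
qed (use assms in auto)

lemma outs_omega1_l:
  assumes "wf_word w [Cap i d, Cross c (Suc i), Cup i]"
  shows "outs w [Cap i d, Cross c (Suc i), Cup i] = w"
proof (intro list_eq_nthI ext)
  fix p
  show "outs w [Cap i d, Cross c (Suc i), Cup i] ! p = w ! p"
    using assms by (cases rule: position_cases[of p i]) (auto simp: upd2_def del2_def ins2_def less_Suc_eq)
qed (use assms in auto)

text \<open>The cup equation amounts to \<open>(1 + v) * (x - f i) = 0\<close>, and
  \<open>1 + v\<close> is a unit because \<open>v\<close> has square 0. So the loop carries the
  value of the strand itself, and all corrections at the crossing vanish.\<close>

lemma run_omega1_r:
  assumes "wf_word w [Cap (Suc i) d, Cross c i, Cup (Suc i)]"
  shows "run w [Cap (Suc i) d, Cross c i, Cup (Suc i)] f f' \<longleftrightarrow> f = f'"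
proof -
  define u v where "u = vw c (w ! i)" and "v = vw c d"
  have uv: "re u = 0" "re v = 0" by (auto simp: u_def v_def)
  let ?g = "\<lambda>x. crossf u v i (ins2 (Suc i) x x f)"
  have iff: "?g x (Suc i) = ?g x (Suc (Suc i)) \<longleftrightarrow> x = f i" for x
    using uv by (auto simp: crossf_def upd2_def ins2_def dnum_eq_iff algebra_simps)
  have eq: "del2 (Suc i) (?g (f i)) = f"
  proof
    fix p
    show "del2 (Suc i) (?g (f i)) p = f p"
      by (cases rule: position_cases[of p i]) (auto simp: crossf_def upd2_def ins2_def del2_def)
  qed
  have "run w [Cap (Suc i) d, Cross c i, Cup (Suc i)] f f' \<longleftrightarrow>
      (\<exists>x. ?g x (Suc i) = ?g x (Suc (Suc i)) \<and> f' = del2 (Suc i) (?g x))"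
    using assms by (auto simp: ins2_apply u_def v_def)
  then show ?thesis using iff eq by auto
qed

lemma run_omega1_l:
  assumes "wf_word w [Cap i d, Cross c (Suc i), Cup i]"
  shows "run w [Cap i d, Cross c (Suc i), Cup i] f f' \<longleftrightarrow> f = f'"
proof -
  define u v where "u = vw c (\<not> d)" and "v = vw c (w ! i)"
  have uv: "re u = 0" "re v = 0" by (auto simp: u_def v_def)
  let ?g = "\<lambda>x. crossf u v (Suc i) (ins2 i x x f)"
  have iff: "?g x i = ?g x (Suc i) \<longleftrightarrow> x = f i" for x
    using uv by (auto simp: crossf_def upd2_def ins2_def dnum_eq_iff algebra_simps)
  have eq: "del2 i (?g (f i)) = f"
  proof
    fix p
    show "del2 i (?g (f i)) p = f p"
      by (cases rule: position_cases[of p i]) (auto simp: crossf_def upd2_def ins2_def del2_def)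
  qed
  have "run w [Cap i d, Cross c (Suc i), Cup i] f f' \<longleftrightarrow>
      (\<exists>x. ?g x i = ?g x (Suc i) \<and> f' = del2 i (?g x))"
    using assms by (auto simp: ins2_apply u_def v_def)
  then show ?thesis using iff eq by auto
qed

lemma outs_omega2:
  "Suc i < length w \<Longrightarrow> outs w [Cross c i, Cross c' i] = w"
  by (rule list_eq_nthI) (auto simp: upd2_def)

lemma run_omega2:
  assumes "Suc i < length w" "\<And>e. vw c' e = vw c e"
  shows "run w [Cross c i, Cross c' i] f f' \<longleftrightarrow> f = f'"
proof -
  \<comment> \<open>The first crossing exchanges the strands, hence also \<open>u\<close> and
    \<open>v\<close>; the corrections cancel since products of two weights are 0.\<close>
  have "crossf v u i (crossf u v i f) = f" if "re u = 0" "re v = 0" for u v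
    using that by (auto simp: fun_eq_iff crossf_def upd2_def dnum_eq_iff algebra_simps)
  then show ?thesis using assms by (auto simp: upd2_apply)
qed

lemma outs_omega3:
  assumes "wf_word w [Cross a i, Cross b (Suc i), Cross c i]"
  shows "outs w [Cross a i, Cross b (Suc i), Cross c i] =
    outs w [Cross c (Suc i), Cross b i, Cross a (Suc i)]"
  using assms by (intro list_eq_nthI) (auto simp: upd2_def fun_eq_iff)

text \<open>Products of two weights vanish, so each crossing only adds its weight times the
  difference of the constant terms of its two strands. Constant terms are carried along the strands
  unchanged, so the three corrections are the same in either order.\<close>

lemma run_omega3:
  assumes "wf_word w [Cross a i, Cross b (Suc i), Cross c i]"
  shows "run w [Cross a i, Cross b (Suc i), Cross c i] f f' \<longleftrightarrow>
    run w [Cross c (Suc i), Cross b i, Cross a (Suc i)] f f'"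
proof -
  have "crossf c1 c2 i (crossf b1 b2 (Suc i) (crossf a1 a2 i f)) =
      crossf a1 a2 (Suc i) (crossf b1 b2 i (crossf c1 c2 (Suc i) f))"
    if "re a1 = 0" "re a2 = 0" "re b1 = 0" "re b2 = 0" "re c1 = 0" "re c2 = 0" for a1 a2 b1 b2 c1 c2
    using that by (auto simp: fun_eq_iff crossf_def upd2_def dnum_eq_iff algebra_simps)
  then show ?thesis using assms by (auto simp: upd2_apply)
qed

lemma lrel_outs:
  assumes "lrel U V" "wf_word w U" "wf_word w V"
  shows "outs w U = outs w V"
  using assms
proof (cases rule: lrel.cases)
  case slide_cap
  with assms show ?thesis using outs_slide_cap by blast
next
  case slide_cup
  with assms show ?thesis using outs_slide_cup by blast
qed (use assms outs_far_comm outs_zigzag1 outs_zigzag2 outs_omega1_r outs_omega1_l outs_omega2 outs_omega3 in auto)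

lemma lrel_run:
  assumes "lrel U V" "wf_word w U" "wf_word w V"
  shows "run w U f f' \<longleftrightarrow> run w V f f'"
  using assms
proof (cases rule: lrel.cases)
  case (far_comm g h)
  with assms show ?thesis using run_far_comm by blast
next
  case zigzag1
  then show ?thesis by (simp add: run_zigzag1 del: run.simps(2))
next
  case zigzag2
  then show ?thesis by (simp add: run_zigzag2 del: run.simps(2))
next
  case slide_cap
  with assms show ?thesis using run_slide_cap vw_flip by blast
next
  case slide_cup
  with assms show ?thesis using run_slide_cup vw_flip by blast
next
  case omega1_r
  with assms show ?thesis by (simp add: run_omega1_r del: run.simps(2) wf_word.simps(2))
next
  case omega1_l
  with assms show ?thesis by (simp add: run_omega1_l del: run.simps(2) wf_word.simps(2))
next
  case (omega2 b i)
  then have "Suc i < length w" using assms by simp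
  then show ?thesis using omega2 by (simp add: run_omega2 del: run.simps(2))
next
  case (omega2v i)
  then have "Suc i < length w" using assms by simp
  then show ?thesis using omega2v by (simp add: run_omega2 del: run.simps(2))
next
  case omega3
  with assms show ?thesis using run_omega3 by blast
qed

section \<open>Harmonic functions on a slice\<close>

fun entering :: "gen \<Rightarrow> bool list \<Rightarrow> bool \<Rightarrow> nat \<Rightarrow> bool" where
  "entering g w True p = (p < length w \<and> w ! p)"
| "entering g w False p = (p < length (gen_out g w) \<and> \<not> gen_out g w ! p)"

text \<open>Complementary to \<open>entering\<close>: by its orientation every boundary point of the
  slice is exactly one of the two.\<close>

fun exiting :: "gen \<Rightarrow> bool list \<Rightarrow> ex \<Rightarrow> bool" where
  "exiting g w (Dn q) = (q < length (gen_out g w) \<and> gen_out g w ! q)"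
| "exiting g w (Up q) = (q < length w \<and> \<not> w ! q)"

fun exval :: "(nat \<Rightarrow> 'a) \<Rightarrow> (nat \<Rightarrow> 'a) \<Rightarrow> ex \<Rightarrow> 'a" where
  "exval f f' (Up q) = f q"
| "exval f f' (Dn q) = f' q"

definition average :: "(dnum \<times> 'a) list \<Rightarrow> ('a \<Rightarrow> dnum) \<Rightarrow> dnum" where
  "average xs h = sum_list (map (\<lambda>(a, z). a * h z) xs)"

lemma average_simps [simp]: "average [] h = 0" "average ((a, z) # xs) h = a * h z + average xs h"
  by (auto simp: average_def)

text \<open>The qualitative facts on which the path argument rests: the weights sum to 1, a jump has
  zero constant term, and the last entry, which \<open>cont\<close> follows, has constant term 1.
  The exits are distinct, so \<open>tw\<close> does not merge the two weights.\<close>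

lemma slice_step_shape:
  "(\<exists>e. slice_step g w t p = [(1, e)]) \<or>
   (\<exists>u e e'. slice_step g w t p = [(u, e'), (1 - u, e)] \<and> re u = 0 \<and> e \<noteq> e')"
proof -
  define P :: "(dnum \<times> ex) list \<Rightarrow> bool" where "P xs \<longleftrightarrow> (\<exists>e. xs = [(1, e)]) \<or>
    (\<exists>u e e'. xs = [(u, e'), (1 - u, e)] \<and> re u = 0 \<and> e \<noteq> e')" for xs
  have P1: "P [(1, e)]" for e
    by (simp add: P_def)
  have P2: "P [(svar, e'), (1 - svar, e)]" "P [(- svar, e'), (1 + svar, e)]" if "e \<noteq> e'" for e e'
    using that by (auto simp: P_def)
  have "P (slice_step g w t p)"
  proof (cases g)
    case (Cross c i)
    have "exitA w i \<noteq> exitB w i" "exitB w i \<noteq> exitA w i"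
      by (auto simp: exitA_def exitB_def)
    then show ?thesis
      by (cases c) (simp_all add: Cross Let_def P1 P2)
  qed (simp_all add: P1)
  then show ?thesis by (simp add: P_def)
qed

lemma exiting_slice_step:
  assumes "gen_ok g w" "entering g w t p" "(a, e) \<in> set (slice_step g w t p)"
  shows "exiting g w e"
proof (cases g)
  case (Cross c i)
  then show ?thesis using assms
    by (cases c; cases t) (auto simp: Let_def exitA_def exitB_def upd2_def split: if_splits)
next
  case (Cup i)
  then show ?thesis using assms
    by (cases t; cases rule: position_cases[of p i]) (auto simp: del2_def)
next
  case (Cap i d)
  then show ?thesis using assms
    by (cases t; cases rule: position_cases[of p i]) (auto simp: ins2_def)
qed

text \<open>The last entry of \<open>slice_step\<close> is the exit along the ball's own strand, and
  the strands of a slice join its entries to its exits one to one.\<close>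

lemma slice_step_own_inj:
  assumes "gen_ok g w" "entering g w t p" "entering g w t' p'"
    "snd (last (slice_step g w t p)) = snd (last (slice_step g w t' p'))"
  shows "t = t' \<and> p = p'"
proof (cases g)
  case (Cross c i)
  then show ?thesis using assms
    by (cases c; cases t; cases t') (auto simp: Let_def exitA_def exitB_def upd2_def split: if_splits)
next
  case (Cup i)
  then show ?thesis using assms
    by (cases t; cases t'; cases rule: position_cases[of p i]; cases rule: position_cases[of p' i]) (auto simp: del2_def)
next
  case (Cap i d)
  then show ?thesis using assms
    by (cases t; cases t'; cases rule: position_cases[of p i]; cases rule: position_cases[of p' i]) (auto simp: ins2_def)
qed

section \<open>Harmonicity on a slice amounts to the linear relation\<close>

definition harmonic_slice :: "gen \<Rightarrow> bool list \<Rightarrow> (nat \<Rightarrow> dnum) \<Rightarrow> (nat \<Rightarrow> dnum) \<Rightarrow> bool" where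
  "harmonic_slice g w f f' \<longleftrightarrow> (\<forall>t p. entering g w t p \<longrightarrow>
     (if t then f p else f' p) = average (slice_step g w t p) (exval f f'))"

lemma tstep_imp_harmonic:
  assumes "gen_ok g w" "tstep w g f f'"
  shows "harmonic_slice g w f f'"
  unfolding harmonic_slice_def
proof (intro allI impI)
  fix t p
  assume "entering g w t p"
  then show "(if t then f p else f' p) = average (slice_step g w t p) (exval f f')"
    using assms
  proof (cases g)
    case (Cross c i)
    then show ?thesis using assms \<open>entering g w t p\<close>
      by (cases c; cases t) (auto simp: Let_def exitA_def exitB_def upd2_def crossf_def dnum_eq_iff algebra_simps)
  next
    case (Cup i)
    then show ?thesis using assms \<open>entering g w t p\<close>
      by (cases t; cases rule: position_cases[of p i]) (auto simp: del2_def)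
  next
    case (Cap i d)
    then show ?thesis using assms \<open>entering g w t p\<close>
      by (cases t; cases rule: position_cases[of p i]) (auto simp: ins2_def)
  qed
qed

text \<open>\<open>tstep\<close> equates functions on all of \<open>nat\<close>, while harmonicity
  speaks only of points of the slice; the values beyond the two widths are therefore fixed to be
  0.\<close>

lemma harmonic_imp_tstep:
  assumes ok: "gen_ok g w" and h: "harmonic_slice g w f f'"
    and z: "\<And>p. length w \<le> p \<Longrightarrow> f p = 0" "\<And>p. length (gen_out g w) \<le> p \<Longrightarrow> f' p = 0"
  shows "tstep w g f f'"
proof -
  have top: "p < length w \<Longrightarrow> w ! p \<Longrightarrow> f p = average (slice_step g w True p) (exval f f')"
    and bot: "p < length (gen_out g w) \<Longrightarrow> \<not> gen_out g w ! p \<Longrightarrow>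
      f' p = average (slice_step g w False p) (exval f f')" for p
    using h unfolding harmonic_slice_def by (metis entering.simps)+
  show ?thesis
  proof (cases g)
    case (Cross c i)
    have "f' p = crossf (vw c (w ! i)) (vw c (w ! Suc i)) i f p" for p
    proof -
      consider "p \<noteq> i" "p \<noteq> Suc i" | "p = i \<or> p = Suc i" by blast
      then show ?thesis
      proof cases
        case 1
        then have step: "slice_step g w t p = [(1, if t then Dn p else Up p)]" for t
          using Cross by simp
        have out: "length (gen_out g w) = length w" "gen_out g w ! p = w ! p"
          using 1 Cross ok by (auto simp: upd2_def)
        have "f' p = f p"
        proof (cases "p < length w")
          case True
          then show ?thesis using top[of p] bot[of p] by (cases "w ! p") (simp_all add: step out)
        next
          case False
          then show ?thesis using z[of p] by (simp add: out)
        qed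
        then show ?thesis using 1 by (simp add: crossf_def upd2_def)
      next
        case 2
        have len: "i < length w" "Suc i < length w" "length (gen_out g w) = length w"
          and out: "gen_out g w ! i = w ! Suc i" "gen_out g w ! Suc i = w ! i"
          using Cross ok by (auto simp: upd2_def)
        \<comment> \<open>In each of the four orientation patterns the two strands give two linear
          equations, which can be solved for the lower values because \<open>svar\<close> has square
          0.\<close>
        have "f' i = f (Suc i) - vw c (w ! i) * (f (Suc i) - f i) \<and>
              f' (Suc i) = f i - vw c (w ! Suc i) * (f (Suc i) - f i)"
        proof (cases "w ! i")
          case o1: True
          note A = top[OF len(1) o1]
          show ?thesis
          proof (cases "w ! Suc i")
            case o2: True
            note B = top[OF len(2) o2]
            show ?thesis using A B o1 o2
              by (cases c) (auto simp: Cross Let_def exitA_def exitB_def dnum_eq_iff)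
          next
            case o2: False
            have B: "f' i = average (slice_step g w False i) (exval f f')"
              using bot[of i] o2 len out by simp
            show ?thesis using A B o1 o2
              by (cases c) (auto simp: Cross Let_def exitA_def exitB_def dnum_eq_iff)
          qed
        next
          case o1: False
          have A: "f' (Suc i) = average (slice_step g w False (Suc i)) (exval f f')"
            using bot[of "Suc i"] o1 len out by simp
          show ?thesis
          proof (cases "w ! Suc i")
            case o2: True
            note B = top[OF len(2) o2]
            show ?thesis using A B o1 o2
              by (cases c) (auto simp: Cross Let_def exitA_def exitB_def dnum_eq_iff)
          next
            case o2: False
            have B: "f' i = average (slice_step g w False i) (exval f f')"
              using bot[of i] o2 len out by simp
            show ?thesis using A B o1 o2
              by (cases c) (auto simp: Cross Let_def exitA_def exitB_def dnum_eq_iff)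
          qed
        qed
        then show ?thesis using 2 by (auto simp: crossf_def upd2_def)
      qed
    qed
    then show ?thesis using Cross by auto
  next
    case (Cup i)
    have "f' p = del2 i f p" for p
    proof (cases "p < i")
      case True
      have out: "p < length (gen_out g w)" "p < length w" "gen_out g w ! p = w ! p"
        using True Cup ok by (auto simp: del2_def)
      have "f' p = f p"
        using top[of p] bot[of p] True Cup out by (cases "w ! p") simp_all
      then show ?thesis using True by (simp add: del2_def)
    next
      case False
      show ?thesis
      proof (cases "Suc (Suc p) < length w")
        case True
        have out: "p < length (gen_out g w)" "gen_out g w ! p = w ! Suc (Suc p)"
          using False True Cup ok by (auto simp: del2_def)
        have "f' p = f (Suc (Suc p))"
          using top[of "Suc (Suc p)"] bot[of p] True False Cup out
          by (cases "w ! Suc (Suc p)") simp_all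
        then show ?thesis using False by (simp add: del2_def)
      next
        case nless: False
        then show ?thesis using Cup ok z(2)[of p] z(1)[of "Suc (Suc p)"] False
          by (auto simp: del2_def)
      qed
    qed
    moreover have "f i = f (Suc i)"
      using Cup ok top[of i] top[of "Suc i"] by (cases "w ! i") simp_all
    ultimately show ?thesis using Cup by auto
  next
    case (Cap i d)
    have eq: "f' i = f' (Suc i)"
      using Cap ok bot[of i] bot[of "Suc i"] by (cases d) (simp_all add: ins2_def)
    \<comment> \<open>The free value of the cap is read off at its left foot.\<close>
    have "f' p = ins2 i (f' i) (f' i) f p" for p
    proof (cases rule: position_cases[of p i])
      case 1
      have out: "p < length (gen_out g w)" "p < length w" "gen_out g w ! p = w ! p"
        using 1 Cap ok by (auto simp: ins2_def)
      have "f' p = f p"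
        using top[of p] bot[of p] 1 Cap out by (cases "w ! p") simp_all
      then show ?thesis using 1 by (simp add: ins2_def)
    next
      case (4 q)
      have out: "length (gen_out g w) = Suc (Suc (length w))" "gen_out g w ! p = w ! q"
        using 4 Cap ok by (auto simp: ins2_def)
      have "f' p = f q"
      proof (cases "q < length w")
        case True
        then show ?thesis
          using top[of q] bot[of p] 4 Cap out by (cases "w ! q") simp_all
      next
        case False
        then show ?thesis using z(1)[of q] z(2)[of p] 4 out by simp
      qed
      then show ?thesis using 4 by (simp add: ins2_def)
    qed (auto simp: ins2_def eq)
    then show ?thesis using Cap by auto
  qed
qed

section \<open>Path sums\<close>

lemma lev_0 [simp]: "lev n D 0 = replicate n True"
  by (simp add: lev_def)

lemma lev_Suc: "k < length D \<Longrightarrow> lev n D (Suc k) = gen_out (D ! k) (lev n D k)"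
  by (simp add: lev_def take_Suc_conv_app_nth)

lemma lev_append: "k \<le> length D \<Longrightarrow> lev n (D @ E) k = lev n D k"
  by (simp add: lev_def)

lemma lev_append_shift:
  "lev n D (length D) = replicate n True \<Longrightarrow> lev n (D @ E) (length D + k) = lev n E k"
  by (simp add: lev_def)

lemma gen_ok_lev:
  assumes "wf_word (replicate n True) D" "k < length D"
  shows "gen_ok (D ! k) (lev n D k)"
proof -
  have "wf_word (replicate n True) (take k D @ D ! k # drop (Suc k) D)"
    using assms by (simp add: id_take_nth_drop[symmetric])
  then show ?thesis by (simp add: wf_append lev_def)
qed

text \<open>The composed relation becomes one function on all points (level, position), the form
  suited to harmonicity. The induction appends at the bottom because levels are counted from the
  top.\<close>

lemma run_iff_levels:
  "run (replicate n True) D f f' \<longleftrightarrow> (\<exists>F. F 0 = f \<and> F (length D) = f' \<and>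
     (\<forall>k < length D. tstep (lev n D k) (D ! k) (F k) (F (Suc k))))"
proof (induction D arbitrary: f' rule: rev_induct)
  case (snoc g D)
  have levels: "(\<forall>k < length (D @ [g]). tstep (lev n (D @ [g]) k) ((D @ [g]) ! k) (F k) (F (Suc k))) \<longleftrightarrow>
     (\<forall>k < length D. tstep (lev n D k) (D ! k) (F k) (F (Suc k))) \<and>
     tstep (lev n D (length D)) g (F (length D)) (F (Suc (length D)))" for F
  proof -
    have "tstep (lev n (D @ [g]) k) ((D @ [g]) ! k) (F k) (F (Suc k)) \<longleftrightarrow>
        tstep (lev n D k) (D ! k) (F k) (F (Suc k))" if "k < length D" for k
      using that by (simp add: nth_append lev_append)
    moreover have "tstep (lev n (D @ [g]) (length D)) ((D @ [g]) ! length D) = tstep (lev n D (length D)) g"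
      by (simp add: lev_append)
    ultimately show ?thesis by (simp add: less_Suc_eq) metis
  qed
  have "run (replicate n True) (D @ [g]) f f' \<longleftrightarrow>
      (\<exists>f1. run (replicate n True) D f f1 \<and> tstep (lev n D (length D)) g f1 f')"
    by (simp add: run_append lev_def)
  also have "\<dots> \<longleftrightarrow> (\<exists>F. F 0 = f \<and> F (Suc (length D)) = f' \<and>
     (\<forall>k < length D. tstep (lev n D k) (D ! k) (F k) (F (Suc k))) \<and>
     tstep (lev n D (length D)) g (F (length D)) (F (Suc (length D))))" (is "?l \<longleftrightarrow> ?r")
  proof
    assume ?l
    then obtain f1 where f1: "run (replicate n True) D f f1" "tstep (lev n D (length D)) g f1 f'"
      by blast
    obtain F where "F 0 = f" "F (length D) = f1" "\<forall>k < length D. tstep (lev n D k) (D ! k) (F k) (F (Suc k))"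
      using f1(1) unfolding snoc by (elim exE conjE)
    with f1(2) show ?r
      by (intro exI[of _ "F(Suc (length D) := f')"]) auto
  next
    assume ?r
    then show ?l unfolding snoc by metis
  qed
  also have "\<dots> \<longleftrightarrow> (\<exists>F. F 0 = f \<and> F (length (D @ [g])) = f' \<and>
     (\<forall>k < length (D @ [g]). tstep (lev n (D @ [g]) k) ((D @ [g]) ! k) (F k) (F (Suc k))))"
    unfolding levels by simp
  finally show ?case .
qed auto

section \<open>Weighted averages and paths with a fixed number of steps\<close>

lemma average_sum: "average xs (\<lambda>z. \<Sum>m \<in> A. h m z) = (\<Sum>m \<in> A. average xs (h m))"
  by (induction xs) (auto simp: sum_distrib_left sum.distrib)

lemma average_diff: "average xs (\<lambda>z. g z - h z) = average xs g - average xs h"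
  by (induction xs) (auto simp: algebra_simps)

lemma average_map: "average (map (\<lambda>(a, e). (a, r e)) xs) h = average xs (\<lambda>e. h (r e))"
  by (induction xs) auto

text \<open>Entries with the same target are collected, which yields the factor \<open>tw\<close>
  occurring in \<open>path_weight\<close>.\<close>

lemma average_eq_sum:
  assumes "finite A" "snd ` set xs \<subseteq> A"
  shows "average xs h = (\<Sum>z \<in> A. sum_list (map fst (filter (\<lambda>(a, z'). z' = z) xs)) * h z)"
  using assms(2)
proof (induction xs)
  case (Cons x xs)
  obtain a z0 where x: "x = (a, z0)" by force
  have "(\<Sum>z \<in> A. sum_list (map fst (filter (\<lambda>(a, z'). z' = z) (x # xs))) * h z) =
     (\<Sum>z \<in> A. (if z0 = z then a * h z else 0) + sum_list (map fst (filter (\<lambda>(a, z'). z' = z) xs)) * h z)"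
    by (intro sum.cong) (auto simp: x algebra_simps)
  also have "\<dots> = a * h z0 + average xs h"
    using Cons assms(1) by (simp add: sum.distrib x)
  finally show ?case by (simp add: x)
qed auto

fun wsum :: "nat \<Rightarrow> gen list \<Rightarrow> point \<Rightarrow> nat \<Rightarrow> point \<Rightarrow> dnum" where
  "wsum n D y 0 x = (if x = y then 1 else 0)"
| "wsum n D y (Suc m) x = average (trans n D x) (wsum n D y m)"

text \<open>Fixing the number of steps makes these sets finite, and disjoint for different
  \<open>m\<close>; \<open>is_path\<close> alone sets no bound on the length, since jumps may lead
  back to earlier points.\<close>

definition paths :: "nat \<Rightarrow> gen list \<Rightarrow> point \<Rightarrow> nat \<Rightarrow> point \<Rightarrow> point list set" where
  "paths n D y m x = {xs. length xs = Suc m \<and> hd xs = x \<and> last xs = y \<and>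
     (\<forall>m. Suc m < length xs \<longrightarrow> xs ! Suc m \<in> snd ` set (trans n D (xs ! m)))}"

lemma paths_0: "paths n D y 0 x = (if x = y then {[x]} else {})"
  by (auto simp: paths_def length_Suc_conv)

lemma paths_Suc:
  "paths n D y (Suc m) x = (\<Union>z \<in> snd ` set (trans n D x). (#) x ` paths n D y m z)"
proof (intro equalityI subsetI)
  fix xs
  assume xs: "xs \<in> paths n D y (Suc m) x"
  then obtain z zs where eq: "xs = x # z # zs"
    by (auto simp: paths_def length_Suc_conv)
  have step: "\<forall>l. Suc l < length xs \<longrightarrow> xs ! Suc l \<in> snd ` set (trans n D (xs ! l))"
    using xs by (simp add: paths_def)
  have "(z # zs) ! Suc l \<in> snd ` set (trans n D ((z # zs) ! l))" if "Suc l < length (z # zs)" for l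
    using spec[OF step, of "Suc l"] that by (simp add: eq)
  moreover have "z \<in> snd ` set (trans n D x)"
    using spec[OF step, of 0] by (simp add: eq)
  moreover have "xs = x # z # zs" "length zs = m" "last (z # zs) = y"
    using xs by (auto simp: paths_def eq)
  moreover have "z # zs \<in> paths n D y m z"
    unfolding paths_def using calculation by simp
  ultimately show "xs \<in> (\<Union>z \<in> snd ` set (trans n D x). (#) x ` paths n D y m z)"
    by blast
next
  fix xs
  assume "xs \<in> (\<Union>z \<in> snd ` set (trans n D x). (#) x ` paths n D y m z)"
  then obtain z zs where z: "z \<in> snd ` set (trans n D x)" "zs \<in> paths n D y m z" "xs = x # zs"
    by blast
  then have "xs ! Suc l \<in> snd ` set (trans n D (xs ! l))" if "Suc l < length xs" for l
    using that by (cases l; cases zs) (auto simp: paths_def)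
  with z show "xs \<in> paths n D y (Suc m) x"
    by (auto simp: paths_def)
qed

lemma finite_paths: "finite (paths n D y m x)"
  by (induction m arbitrary: x) (auto simp: paths_0 paths_Suc)

lemma path_weight_single [simp]: "path_weight n D [x] = 1"
  by (simp add: path_weight_def)

lemma path_weight_Cons:
  assumes "zs \<in> paths n D y m z"
  shows "path_weight n D (x # zs) = tw n D x z * path_weight n D zs"
  using assms by (cases zs)
    (auto simp: paths_def path_weight_def prod.lessThan_Suc_shift simp del: prod.lessThan_Suc)

lemma sum_paths: "(\<Sum>xs \<in> paths n D y m x. path_weight n D xs) = wsum n D y m x"
proof (induction m arbitrary: x)
  case (Suc m)
  have "(\<Sum>xs \<in> paths n D y (Suc m) x. path_weight n D xs) =
      (\<Sum>z \<in> snd ` set (trans n D x). \<Sum>xs \<in> (#) x ` paths n D y m z. path_weight n D xs)"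
    unfolding paths_Suc
    by (rule sum.UNION_disjoint) (auto simp: finite_paths, auto simp: paths_def)
  also have "\<dots> = (\<Sum>z \<in> snd ` set (trans n D x). \<Sum>zs \<in> paths n D y m z. tw n D x z * path_weight n D zs)"
  proof (rule sum.cong)
    fix z
    show "(\<Sum>xs \<in> (#) x ` paths n D y m z. path_weight n D xs) =
        (\<Sum>zs \<in> paths n D y m z. tw n D x z * path_weight n D zs)"
      by (subst sum.reindex) (auto simp: path_weight_Cons intro!: sum.cong)
  qed simp
  also have "\<dots> = (\<Sum>z \<in> snd ` set (trans n D x). tw n D x z * wsum n D y m z)"
    by (simp add: sum_distrib_left[symmetric] Suc)
  also have "\<dots> = average (trans n D x) (wsum n D y m)"
    unfolding tw_def by (rule average_eq_sum[symmetric]) auto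
  finally show ?case by simp
qed (auto simp: paths_0)

section \<open>Points and strings of a valid diagram\<close>

locale string_link =
  fixes n :: nat and D :: "gen list"
  assumes valid: "valid n D"
begin

lemma wf: "wf_word (replicate n True) D" and lev_bottom [simp]: "lev n D (length D) = replicate n True"
  using valid by (auto simp: valid_def)

lemma gen_ok: "k < length D \<Longrightarrow> gen_ok (D ! k) (lev n D k)"
  using gen_ok_lev wf by blast

definition pts :: "point set" where
  "pts = {(k, p). k \<le> length D \<and> p < length (lev n D k)}"

lemma finite_pts: "finite pts"
proof -
  have "pts = (SIGMA k:{..length D}. {..<length (lev n D k)})"
    by (auto simp: pts_def)
  then show ?thesis by simp
qed

lemma trans_entering:
  assumes "k < length D" "entering (D ! k) (lev n D k) t p"
  shows "trans n D (if t then k else Suc k, p) =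
      map (\<lambda>(a, e). (a, glob k e)) (slice_step (D ! k) (lev n D k) t p)"
    and "(if t then k else Suc k, p) \<in> pts"
  using assms by (cases t; simp add: trans_def pts_def lev_Suc)+

lemma pts_cases:
  assumes "x \<in> pts"
  obtains p where "x = (length D, p)" "trans n D x = []" "p < n"
  | k t p where "k < length D" "entering (D ! k) (lev n D k) t p" "x = (if t then k else Suc k, p)"
proof -
  obtain k p where x: "x = (k, p)" by force
  have kp: "k \<le> length D" "p < length (lev n D k)" using assms by (auto simp: x pts_def)
  consider "k = length D" | "lev n D k ! p" "k < length D" | "k \<noteq> length D" "\<not> lev n D k ! p"
    using kp by linarith
  then show ?thesis
  proof cases
    case 1
    then show ?thesis using that(1) kp by (auto simp: x trans_def)
  next
    case 2
    then show ?thesis using that(2)[of k True p] kp by (auto simp: x)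
  next
    case 3
    \<comment> \<open>All points of level 0 are downward, so an upward point lies below some slice
      and enters it from below.\<close>
    then obtain k' where "k = Suc k'"
      using kp by (cases k) auto
    then show ?thesis using that(2)[of k' False p] 3 kp by (auto simp: x lev_Suc)
  qed
qed

lemma trans_outside: "x \<notin> pts \<Longrightarrow> trans n D x = []"
proof -
  assume "x \<notin> pts"
  moreover obtain k p where "x = (k, p)" by force
  \<comment> \<open>Below the bottom \<open>take\<close> is saturated, so \<open>lev\<close> repeats
    the bottom word; its points are all downward and enter no slice.\<close>
  moreover have "lev n D k = replicate n True" if "k > length D"
    using that lev_bottom by (simp add: lev_def)
  ultimately show ?thesis
    by (cases "k \<le> length D") (auto simp: trans_def pts_def)
qed

lemma trans_bottom [simp]: "trans n D (length D, p) = []"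
  by (auto simp: trans_def)

text \<open>The orientation of a point tells how it was reached: a downward point is an exit only of
  the slice above it, an upward point only of the slice below it.\<close>

lemma glob_inj:
  assumes "k < length D" "k' < length D"
    "exiting (D ! k) (lev n D k) e" "exiting (D ! k') (lev n D k') e'" "glob k e = glob k' e'"
  shows "k = k' \<and> e = e'"
  using assms by (cases e; cases e') (auto simp: lev_Suc[symmetric])

lemma glob_in_pts: "k < length D \<Longrightarrow> exiting (D ! k) (lev n D k) e \<Longrightarrow> glob k e \<in> pts"
  by (cases e) (auto simp: pts_def lev_Suc)

lemma trans_nonempty_cases:
  assumes "trans n D x \<noteq> []"
  obtains k t p where "k < length D" "entering (D ! k) (lev n D k) t p"
    "x = (if t then k else Suc k, p)"
  using assms trans_outside pts_cases[of x] by metis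

lemma trans_in_pts:
  assumes "(a, z) \<in> set (trans n D x)"
  shows "z \<in> pts"
proof -
  obtain k t p where "k < length D" "entering (D ! k) (lev n D k) t p"
    "x = (if t then k else Suc k, p)"
    using assms trans_nonempty_cases by (metis list.distinct(1) list.set_cases)
  then show ?thesis
    using assms trans_entering(1) glob_in_pts exiting_slice_step gen_ok by fastforce
qed

lemma trans_shape:
  "trans n D x = [] \<or> (\<exists>z. trans n D x = [(1, z)] \<and> cont n D x z) \<or>
   (\<exists>u z z'. trans n D x = [(u, z'), (1 - u, z)] \<and> re u = 0 \<and> z \<noteq> z' \<and> cont n D x z)"
proof (cases "trans n D x = []")
  case False
  then obtain k t p where k: "k < length D" "entering (D ! k) (lev n D k) t p"
    and x: "x = (if t then k else Suc k, p)"
    using trans_nonempty_cases by blast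
  note tr = trans_entering(1)[OF k, folded x]
  from slice_step_shape[of "D ! k" "lev n D k" t p] show ?thesis
  proof (elim disjE exE conjE)
    fix u e e'
    assume sl: "slice_step (D ! k) (lev n D k) t p = [(u, e'), (1 - u, e)]" "re u = 0" "e \<noteq> e'"
    have "glob k e \<noteq> glob k e'"
      using glob_inj[OF k(1) k(1), of e e'] exiting_slice_step[OF gen_ok k(2)] k(1) sl by auto
    then show ?thesis using sl by (simp add: tr cont_def)
  qed (simp add: tr cont_def)
qed simp

lemma cont_exit:
  assumes "cont n D x y"
  obtains k t p where "k < length D" "entering (D ! k) (lev n D k) t p"
    "x = (if t then k else Suc k, p)"
    "y = glob k (snd (last (slice_step (D ! k) (lev n D k) t p)))"
    "exiting (D ! k) (lev n D k) (snd (last (slice_step (D ! k) (lev n D k) t p)))"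
proof -
  obtain k t p where k: "k < length D" "entering (D ! k) (lev n D k) t p"
    and x: "x = (if t then k else Suc k, p)"
    using assms trans_nonempty_cases by (metis cont_def)
  let ?s = "slice_step (D ! k) (lev n D k) t p"
  have ne: "?s \<noteq> []" using slice_step_shape[of "D ! k" "lev n D k" t p] by auto
  have "y = glob k (snd (last ?s))"
    using assms trans_entering(1)[OF k] ne by (auto simp: cont_def x last_map split: prod.splits)
  moreover have "exiting (D ! k) (lev n D k) (snd (last ?s))"
    using exiting_slice_step[OF gen_ok[OF k(1)] k(2)] ne by (metis last_in_set prod.collapse)
  ultimately show ?thesis using that k x by blast
qed

lemma cont_inj:
  assumes "cont n D x z" "cont n D y z"
  shows "x = y"
proof -
  let ?own = "\<lambda>k t p. snd (last (slice_step (D ! k) (lev n D k) t p))"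
  obtain k t p where x: "k < length D" "entering (D ! k) (lev n D k) t p"
    "x = (if t then k else Suc k, p)" "z = glob k (?own k t p)" "exiting (D ! k) (lev n D k) (?own k t p)"
    using cont_exit[OF assms(1)] by blast
  obtain l s q where y: "l < length D" "entering (D ! l) (lev n D l) s q"
    "y = (if s then l else Suc l, q)" "z = glob l (?own l s q)" "exiting (D ! l) (lev n D l) (?own l s q)"
    using cont_exit[OF assms(2)] by blast
  have kl: "k = l" "?own k t p = ?own l s q"
    using glob_inj[OF x(1) y(1) x(5) y(5)] x(4) y(4) by auto
  then have "t = s \<and> p = q"
    using slice_step_own_inj[OF gen_ok[OF x(1)] x(2)] y(2) by metis
  then show ?thesis using kl x y by simp
qed

lemma cont_in_pts: "cont n D x z \<Longrightarrow> z \<in> pts"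
  by (elim cont_exit) (auto simp: glob_in_pts)

section \<open>The order along strings and the length of paths of nonzero weight\<close>

lemma not_cont_top: "i < n \<Longrightarrow> \<not> cont n D x (0, i)"
proof
  assume "i < n" "cont n D x (0, i)"
  then obtain k e where "k < length D" "exiting (D ! k) (lev n D k) e" "(0, i) = glob k e"
    by (elim cont_exit) blast
  then show False using \<open>i < n\<close> by (cases e) auto
qed

text \<open>Induction along the string from its top endpoint. The top has no predecessor, and since
  predecessors are unique, a cycle through a point also passes through the point before it.\<close>

lemma cont_acyclic:
  assumes "x \<in> pts"
  shows "\<not> (cont n D)\<^sup>+\<^sup>+ x x"
proof -
  have "\<exists>i < n. (cont n D)\<^sup>*\<^sup>* (0, i) x"
    using assms valid by (auto simp: pts_def valid_def)
  then obtain i where "i < n" "(cont n D)\<^sup>*\<^sup>* (0, i) x" by blast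
  from this(2) show ?thesis
  proof (induction rule: rtranclp_induct)
    case base
    show ?case
      using not_cont_top[OF \<open>i < n\<close>] by (metis tranclp.cases)
  next
    case (step y z)
    show ?case
    proof
      assume "(cont n D)\<^sup>+\<^sup>+ z z"
      then obtain c where "(cont n D)\<^sup>*\<^sup>* z c" "cont n D c z"
        by (metis tranclpD tranclp_rtranclp_tranclp rtranclp.rtrancl_refl tranclp.cases tranclp_into_rtranclp)
      then have "(cont n D)\<^sup>*\<^sup>* z y" using cont_inj step(2) by blast
      then have "(cont n D)\<^sup>+\<^sup>+ y y" using step(2) by (rule rtranclp_into_tranclp2[rotated])
      then show False using step by blast
    qed
  qed
qed

text \<open>Termination measure: the number of points still ahead on the string of
  \<open>x\<close>.\<close>

definition rank :: "point \<Rightarrow> nat" where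
  "rank x = card {y. (cont n D)\<^sup>+\<^sup>+ x y}"

lemma reachable_subset: "{y. (cont n D)\<^sup>+\<^sup>+ x y} \<subseteq> pts"
  using cont_in_pts by (auto elim: tranclp.cases)

lemma rank_le: "rank x \<le> card pts"
  unfolding rank_def by (intro card_mono finite_pts reachable_subset)

lemma rank_less:
  assumes "cont n D x z"
  shows "rank z < rank x"
  unfolding rank_def
proof (rule psubset_card_mono)
  show "finite {y. (cont n D)\<^sup>+\<^sup>+ x y}"
    using finite_pts reachable_subset finite_subset by blast
  show "{y. (cont n D)\<^sup>+\<^sup>+ z y} \<subset> {y. (cont n D)\<^sup>+\<^sup>+ x y}"
    using assms cont_acyclic[of z] cont_in_pts[OF assms] by (auto intro: tranclp_into_tranclp2)
qed

lemma re_tw_nonzero: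
  assumes "z \<in> snd ` set (trans n D x)" "re (tw n D x z) \<noteq> 0"
  shows "cont n D x z"
  using assms trans_shape[of x] by (auto simp: tw_def split: if_splits)

text \<open>A jump has no constant term, so such a path never leaves its string, and each step
  lowers the rank.\<close>

lemma path_re_bound:
  "xs \<in> paths n D y m x \<Longrightarrow> re (path_weight n D xs) \<noteq> 0 \<Longrightarrow> m \<le> rank x"
proof (induction m arbitrary: x xs)
  case (Suc m)
  then obtain z zs where z: "z \<in> snd ` set (trans n D x)" "zs \<in> paths n D y m z" "xs = x # zs"
    unfolding paths_Suc by blast
  then have "re (tw n D x z) \<noteq> 0" "re (path_weight n D zs) \<noteq> 0"
    using Suc.prems by (auto simp: path_weight_Cons)
  then have "rank z < rank x" "m \<le> rank z"
    using Suc.IH z re_tw_nonzero rank_less by blast+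
  then show ?case by simp
qed simp

text \<open>A path of nonzero weight follows strings except for at most one jump.\<close>

lemma path_bound:
  "xs \<in> paths n D y m x \<Longrightarrow> path_weight n D xs \<noteq> 0 \<Longrightarrow> m \<le> rank x + card pts + 1"
proof (induction m arbitrary: x xs)
  case (Suc m)
  then obtain z zs where z: "z \<in> snd ` set (trans n D x)" "zs \<in> paths n D y m z" "xs = x # zs"
    unfolding paths_Suc by blast
  then have ne: "tw n D x z * path_weight n D zs \<noteq> 0"
    using Suc.prems by (auto simp: path_weight_Cons)
  show ?case
  proof (cases "re (tw n D x z) = 0")
    case True
    \<comment> \<open>The first step is a jump. Two factors without constant term multiply to 0, so
      the rest of the path must have one.\<close>
    then have "re (path_weight n D zs) \<noteq> 0"
      using ne by (auto simp: dnum_eq_iff)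
    then show ?thesis
      using path_re_bound z(2) rank_le[of z] by fastforce
  next
    case False
    then have "rank z < rank x"
      using z(1) re_tw_nonzero rank_less by blast
    moreover have "path_weight n D zs \<noteq> 0" using ne by auto
    then have "m \<le> rank z + card pts + 1" using Suc.IH z(2) by blast
    ultimately show ?thesis by simp
  qed
qed simp

section \<open>Total path weights as a harmonic function\<close>

definition N :: nat where "N = 2 * card pts + 2"

text \<open>\<open>path_bound\<close> and \<open>rank_le\<close> allow at most
  \<open>2 * card pts + 1\<close> steps, one less than \<open>N\<close>.\<close>

lemma path_weight_long: "xs \<in> paths n D y m x \<Longrightarrow> N \<le> m \<Longrightarrow> path_weight n D xs = 0"
  using path_bound[of xs y m x] rank_le[of x] unfolding N_def by linarith

text \<open>The total weight of all paths from \<open>x\<close> to \<open>y\<close>, since longer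
  ones have weight 0.\<close>

definition h :: "point \<Rightarrow> point \<Rightarrow> dnum" where
  "h y x = (\<Sum>m<N. wsum n D y m x)"

text \<open>The term for \<open>N\<close> steps vanishes, so it may be added and the summation
  shifted by one; splitting off the first step then gives the average.\<close>

lemma h_harmonic: "h y x = (if x = y then 1 else 0) + average (trans n D x) (h y)"
proof -
  have "wsum n D y N x = 0"
    unfolding sum_paths[symmetric] by (intro sum.neutral) (auto simp: path_weight_long)
  then have "h y x = (\<Sum>m<Suc N. wsum n D y m x)"
    by (simp add: h_def del: wsum.simps)
  also have "\<dots> = wsum n D y 0 x + (\<Sum>m<N. wsum n D y (Suc m) x)"
    by (rule sum.lessThan_Suc_shift)
  also have "\<dots> = (if x = y then 1 else 0) + average (trans n D x) (\<lambda>z. \<Sum>m<N. wsum n D y m z)"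
    by (simp only: wsum.simps average_sum)
  also have "(\<lambda>z. \<Sum>m<N. wsum n D y m z) = h y"
    by (simp add: h_def fun_eq_iff)
  finally show ?thesis .
qed

lemma bb_entry_eq: "bb_entry n D i j = h (length D, j) (0, i)"
proof -
  let ?P = "\<lambda>m. paths n D (length D, j) m (0, i)"
  have "bb_entry n D i j = (\<Sum>xs \<in> (\<Union>m<N. ?P m). path_weight n D xs)"
    unfolding bb_entry_def
  \<comment> \<open>Adding paths of weight 0 turns the index set into a finite union over the number
    of steps.\<close>
  proof (rule sum.mono_neutral_left)
    show "finite (\<Union>m<N. ?P m)" by (auto simp: finite_paths)
    show "{xs. is_path n D i j xs \<and> path_weight n D xs \<noteq> 0} \<subseteq> (\<Union>m<N. ?P m)"
    proof safe
      fix xs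
      assume xs: "is_path n D i j xs" "path_weight n D xs \<noteq> 0"
      then have "xs \<in> ?P (length xs - 1)"
        by (auto simp: is_path_def paths_def)
      moreover from this have "length xs - 1 < N"
        using xs(2) path_weight_long by (meson not_le)
      ultimately show "xs \<in> (\<Union>m<N. ?P m)" by blast
    qed
    show "\<forall>xs \<in> (\<Union>m<N. ?P m) - {xs. is_path n D i j xs \<and> path_weight n D xs \<noteq> 0}. path_weight n D xs = 0"
      by (auto simp: is_path_def paths_def)
  qed
  also have "\<dots> = (\<Sum>m<N. \<Sum>xs \<in> ?P m. path_weight n D xs)"
    by (rule sum.UNION_disjoint) (auto simp: finite_paths, auto simp: paths_def)
  also have "\<dots> = h (length D, j) (0, i)"
    by (simp add: sum_paths h_def)
  finally show ?thesis .
qed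

lemma average_trans_re:
  "trans n D x = [] \<or> (\<exists>z. cont n D x z \<and> re (average (trans n D x) g) = re (g z))"
  using trans_shape[of x]
proof (elim disjE exE conjE)
  fix u z z'
  assume tr: "trans n D x = [(u, z'), (1 - u, z)]" "re u = 0" "cont n D x z"
  then have "re (average (trans n D x) g) = re (g z)" by simp
  with tr show ?thesis by blast
next
  fix z
  assume tr: "trans n D x = [(1, z)]" "cont n D x z"
  then have "re (average (trans n D x) g) = re (g z)" by simp
  with tr show ?thesis by blast
qed simp

text \<open>Jumps do not affect the constant term, so it is constant along a string and is decided
  at its end: 1 if the string ends at \<open>y\<close>, otherwise 0.\<close>

lemma re_h: "re (h y x) \<in> {0, 1}" if "trans n D y = []"
proof (induction "rank x" arbitrary: x rule: less_induct)
  case less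
  from average_trans_re[of x "h y"] show ?case
  proof (elim disjE exE conjE)
    assume "trans n D x = []"
    then show ?thesis by (simp add: h_harmonic[of y x])
  next
    fix z
    assume z: "cont n D x z" "re (average (trans n D x) (h y)) = re (h y z)"
    then have "x \<noteq> y" using that by (auto simp: cont_def)
    then have "re (h y x) = re (h y z)" using z(2) by (simp add: h_harmonic[of y x])
    then show ?thesis using less rank_less[OF z(1)] by simp
  qed
qed

text \<open>At points without successors the average is 0, so the hypothesis contains zero boundary
  values. These spread backwards along strings by induction on the rank, first for
  \<open>re\<close>, then for \<open>ep\<close>.\<close>

lemma harmonic_zero:
  assumes "\<And>x. x \<in> pts \<Longrightarrow> g x = average (trans n D x) g" "x \<in> pts"
  shows "g x = 0"
proof -
  have re: "re (g x) = 0" if "x \<in> pts" for x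
    using that
  proof (induction "rank x" arbitrary: x rule: less_induct)
    case less
    from average_trans_re[of x g] show ?case
    proof (elim disjE exE conjE)
      fix z
      assume "cont n D x z" "re (average (trans n D x) g) = re (g z)"
      then show ?thesis
        using assms(1)[OF less.prems] less.hyps[of z] rank_less cont_in_pts by metis
    qed (use assms(1)[OF less.prems] in simp)
  qed
  have "ep (g x) = 0"
    using assms(2)
  proof (induction "rank x" arbitrary: x rule: less_induct)
    case less
    from trans_shape[of x] show ?case
    proof (elim disjE exE conjE)
      fix u z z'
      assume tr: "trans n D x = [(u, z'), (1 - u, z)]" "re u = 0" "cont n D x z"
      \<comment> \<open>The jump contributes \<open>ep u * re (g z')\<close>, which is 0 by the
        first induction; only \<open>z\<close>, of smaller rank, remains.\<close>
      have "z \<in> pts" "z' \<in> pts"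
        using trans_in_pts[of u z' x] trans_in_pts[of "1 - u" z x] tr(1) by auto
      then show ?thesis
        using assms(1)[OF less.prems] tr re less.hyps rank_less by simp
    next
      fix z
      assume "trans n D x = [(1, z)]" "cont n D x z"
      then show ?thesis
        using assms(1)[OF less.prems] less.hyps[of z] rank_less cont_in_pts by simp
    qed (use assms(1)[OF less.prems] in simp)
  qed
  with re[OF assms(2)] show ?thesis by (simp add: dnum_eq_iff)
qed

lemma average_trans_entering:
  assumes "k < length D" "entering (D ! k) (lev n D k) t p"
  shows "average (trans n D (if t then k else Suc k, p)) (\<lambda>(k, p). F k p) =
    average (slice_step (D ! k) (lev n D k) t p) (exval (F k) (F (Suc k)))"
proof -
  have "(\<lambda>e. case glob k e of (k, p) \<Rightarrow> F k p) = exval (F k) (F (Suc k))"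
  proof
    fix e show "(case glob k e of (k, p) \<Rightarrow> F k p) = exval (F k) (F (Suc k)) e"
      by (cases e) auto
  qed
  then show ?thesis
    unfolding trans_entering(1)[OF assms] average_map by simp
qed

text \<open>The levels in between are filled by \<open>h (length D, j)\<close>, which is harmonic
  except at its target, a bottom point that enters no slice.\<close>

lemma run_bb_entry:
  assumes "j < n"
  shows "run (replicate n True) D (\<lambda>i. if i < n then bb_entry n D i j else 0) (\<lambda>p. if p = j then 1 else 0)"
proof -
  define F where "F k p = h (length D, j) (k, p)" for k p
  \<comment> \<open>No step starts outside the diagram, so \<open>h\<close> is 0 there, as
    \<open>harmonic_imp_tstep\<close> demands.\<close>
  have out: "F k p = 0" if "k \<le> length D" "p \<ge> length (lev n D k)" for k p
  proof -
    have "(k, p) \<notin> pts" "(k, p) \<noteq> (length D, j)"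
      using that assms by (auto simp: pts_def)
    then show ?thesis
      unfolding F_def by (subst h_harmonic) (simp add: trans_outside)
  qed
  have "F 0 = (\<lambda>i. if i < n then bb_entry n D i j else 0)"
    using out[of 0] by (auto simp: fun_eq_iff bb_entry_eq F_def)
  moreover have "F (length D) = (\<lambda>p. if p = j then 1 else 0)"
    by (auto simp: F_def fun_eq_iff h_harmonic[of _ "(length D, _)"])
  moreover have "tstep (lev n D k) (D ! k) (F k) (F (Suc k))" if k: "k < length D" for k
  proof (rule harmonic_imp_tstep)
    show "gen_ok (D ! k) (lev n D k)" using gen_ok k by simp
    show "F k p = 0" if "length (lev n D k) \<le> p" for p using out that k by simp
    show "F (Suc k) p = 0" if "length (gen_out (D ! k) (lev n D k)) \<le> p" for p
      using out that k by (simp add: lev_Suc)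
    show "harmonic_slice (D ! k) (lev n D k) (F k) (F (Suc k))"
      unfolding harmonic_slice_def
    proof (intro allI impI)
      fix t p
      assume en: "entering (D ! k) (lev n D k) t p"
      let ?x = "(if t then k else Suc k, p)"
      have "slice_step (D ! k) (lev n D k) t p \<noteq> []"
        using slice_step_shape[of "D ! k" "lev n D k" t p] by auto
      then have "trans n D ?x \<noteq> []"
        unfolding trans_entering(1)[OF k en] by simp
      then have "?x \<noteq> (length D, j)"
        using trans_bottom[of j] by metis
      then have "h (length D, j) ?x = average (trans n D ?x) (h (length D, j))"
        by (subst h_harmonic) simp
      also have "h (length D, j) = (\<lambda>(k, p). F k p)"
        by (auto simp: F_def)
      finally show "(if t then F k p else F (Suc k) p) =
          average (slice_step (D ! k) (lev n D k) t p) (exval (F k) (F (Suc k)))"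
        unfolding average_trans_entering[OF k en] by (simp split: if_splits)
    qed
  qed
  ultimately show ?thesis unfolding run_iff_levels by blast
qed

text \<open>The difference of two solutions is harmonic and 0 at the bottom, so
  \<open>harmonic_zero\<close> applies.\<close>

lemma run_unique:
  assumes "run (replicate n True) D f e" "run (replicate n True) D f' e" "i < n"
  shows "f i = f' i"
proof -
  obtain F where F: "F 0 = f" "F (length D) = e"
    "\<And>k. k < length D \<Longrightarrow> tstep (lev n D k) (D ! k) (F k) (F (Suc k))"
    using assms(1) unfolding run_iff_levels by blast
  obtain F' where F': "F' 0 = f'" "F' (length D) = e"
    "\<And>k. k < length D \<Longrightarrow> tstep (lev n D k) (D ! k) (F' k) (F' (Suc k))"
    using assms(2) unfolding run_iff_levels by blast
  define g where "g = (\<lambda>x. (case x of (k, p) \<Rightarrow> F k p) - (case x of (k, p) \<Rightarrow> F' k p))"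
  have "g x = average (trans n D x) g" if "x \<in> pts" for x
    using that
  proof (cases rule: pts_cases)
    case (1 p)
    then show ?thesis by (simp add: g_def F F')
  next
    case (2 k t p)
    have harm: "harmonic_slice (D ! k) (lev n D k) (F k) (F (Suc k))"
      "harmonic_slice (D ! k) (lev n D k) (F' k) (F' (Suc k))"
      using tstep_imp_harmonic gen_ok 2(1) F(3) F'(3) by blast+
    note eqs = harm[unfolded harmonic_slice_def, rule_format, OF 2(2)]
    show ?thesis
      unfolding g_def average_diff 2(3) average_trans_entering[OF 2(1,2)] eqs[symmetric]
      by simp
  qed
  then have "g (0, i) = 0"
    using assms(3) by (intro harmonic_zero) (auto simp: pts_def)
  then show ?thesis by (simp add: g_def F F')
qed

end

section \<open>Invariance and multiplicativity\<close>

lemma tstep_scale: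
  "tstep w g f f' \<Longrightarrow> tstep w g (\<lambda>p. c * f p) (\<lambda>p. c * f' p)"
  by (cases g)
    (auto simp: fun_eq_iff crossf_def upd2_def del2_def ins2_def algebra_simps)

lemma tstep_add:
  "tstep w g f f' \<Longrightarrow> tstep w g h h' \<Longrightarrow> tstep w g (\<lambda>p. f p + h p) (\<lambda>p. f' p + h' p)"
proof (cases g)
  case (Cap i d)
  assume "tstep w g f f'" "tstep w g h h'"
  then obtain x y where "f' = ins2 i x x f" "h' = ins2 i y y h"
    using Cap by auto
  then have "(\<lambda>p. f' p + h' p) = ins2 i (x + y) (x + y) (\<lambda>p. f p + h p)"
    by (auto simp: ins2_def)
  then show ?thesis using Cap by auto
qed (auto simp: fun_eq_iff crossf_def upd2_def del2_def algebra_simps)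

lemma run_scale: "run w D f f' \<Longrightarrow> run w D (\<lambda>p. c * f p) (\<lambda>p. c * f' p)"
  by (induction D arbitrary: w f) (auto intro: tstep_scale)

lemma run_add:
  "run w D f f' \<Longrightarrow> run w D h h' \<Longrightarrow> run w D (\<lambda>p. f p + h p) (\<lambda>p. f' p + h' p)"
  by (induction D arbitrary: w f h) (auto intro: tstep_add)

lemma tstep_zero: "tstep w g (\<lambda>p. 0) (\<lambda>p. 0)"
proof (cases g)
  case (Cap i d)
  have "(\<lambda>p. 0) = ins2 i 0 0 (\<lambda>p. 0 :: dnum)" by (auto simp: ins2_def)
  then show ?thesis using Cap by auto
qed (auto simp: fun_eq_iff crossf_def upd2_def del2_def)

lemma run_zero: "run w D (\<lambda>p. 0) (\<lambda>p. 0)"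
  by (induction D arbitrary: w) (auto intro: tstep_zero)

lemma run_sum:
  "finite A \<Longrightarrow> (\<And>k. k \<in> A \<Longrightarrow> run w D (f k) (f' k)) \<Longrightarrow>
    run w D (\<lambda>p. \<Sum>k \<in> A. c k * f k p) (\<lambda>p. \<Sum>k \<in> A. c k * f' k p)"
proof (induction A rule: finite_induct)
  case (insert x A)
  then show ?case by (simp add: run_add[OF run_scale])
qed (simp add: run_zero)

section \<open>Invariance under a single move\<close>

lemma bb_matrix_rmove:
  assumes "rmove n D D'"
  shows "bb_matrix n D = bb_matrix n D'"
proof -
  obtain p q U V where D: "D = p @ U @ q" "D' = p @ V @ q" and UV: "lrel U V \<or> lrel V U"
    and valid: "valid n D" "valid n D'"
    using assms by (auto simp: rmove_def)
  interpret A: string_link n D by unfold_locales (fact valid)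
  interpret B: string_link n D' by unfold_locales (fact valid)
  define w where "w = outs (replicate n True) p"
  have wf: "wf_word w U" "wf_word w V"
    using A.wf B.wf by (auto simp: D wf_append w_def)
  \<comment> \<open>\<open>U\<close> and \<open>V\<close> end in the same word, so the remaining
    slices \<open>q\<close> start from equal orientations.\<close>
  have "run (replicate n True) D f f' \<longleftrightarrow> run (replicate n True) D' f f'" for f f'
    using UV lrel_run[OF _ wf] lrel_run[OF _ wf(2,1)] lrel_outs[OF _ wf] lrel_outs[OF _ wf(2,1)]
    unfolding D run_append w_def[symmetric] by metis
  \<comment> \<open>The column of \<open>D\<close> also solves the relation of \<open>D'\<close>
    with bottom values \<open>e_j\<close>, so uniqueness for \<open>D'\<close> identifies the
    columns.\<close>
  then have "bb_entry n D i j = bb_entry n D' i j" if "i < n" "j < n" for i j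
    using B.run_unique[OF _ B.run_bb_entry[OF that(2)] that(1)] A.run_bb_entry[OF that(2)] that by fastforce
  then show ?thesis
    unfolding bb_matrix_def by (intro eq_matI) auto
qed

section \<open>Stacking of diagrams and the trivial diagram\<close>

lemma trans_append:
  assumes "k \<le> length D" "trans n D (k, p) \<noteq> []"
  shows "trans n (D @ E) (k, p) = trans n D (k, p)"
proof (cases "lev n D k ! p")
  case True
  then have "k < length D"
    using assms(2) by (auto simp: trans_def split: if_splits)
  then show ?thesis
    using True by (simp add: trans_def lev_append nth_append)
next
  case False
  then have "0 < k" "k - 1 < length D"
    using assms by (auto simp: trans_def split: if_splits)
  then show ?thesis
    using False assms(1) by (simp add: trans_def lev_append nth_append)
qed

text \<open>The point at issue is reachability: a point of \<open>E\<close> is reached in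
  \<open>E\<close> from some top endpoint, which is now a bottom point of \<open>D\<close> and hence
  reached within \<open>D\<close>.\<close>

lemma valid_append:
  assumes D: "valid n D" and E: "valid n E"
  shows "valid n (D @ E)"
proof -
  interpret D: string_link n D by unfold_locales (fact D)
  interpret E: string_link n E by unfold_locales (fact E)
  note shift = lev_append_shift[OF D.lev_bottom]
  have wf: "wf_word (replicate n True) (D @ E)"
    using D.wf E.wf D.lev_bottom by (simp add: wf_append lev_def)
  have contD: "cont n (D @ E) x y" if "cont n D x y" for x y
  proof -
    obtain k p where x: "x = (k, p)" by force
    have ne: "trans n D (k, p) \<noteq> []" using that by (simp add: x cont_def)
    then have "(k, p) \<in> D.pts" using D.trans_outside by blast
    then have "k \<le> length D"
      by (simp add: D.pts_def)
    from trans_append[OF this ne] that show ?thesis by (simp add: x cont_def)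
  qed
  have contE: "cont n (D @ E) (length D + k, p) (length D + l, q)" if "cont n E (k, p) (l, q)" for k p l q
  proof -
    have eq: "trans n (D @ E) (length D + k, p) = map (\<lambda>(a, (m, r)). (a, (length D + m, r))) (trans n E (k, p))"
    proof -
      have glob: "glob (length D + m) e = (\<lambda>(m, r). (length D + m, r)) (glob m e)" for m e
        by (cases e) auto
      \<comment> \<open>At level 0 of \<open>E\<close> all points are downward, so no step from
        there looks at the last slice of \<open>D\<close>.\<close>
      show ?thesis
        using shift[of E 0] glob[of 0] nth_append_length_plus[of D E 0]
        by (cases k) (auto simp: trans_def shift glob split: prod.splits simp flip: add_Suc_right)
    qed
    show ?thesis
      using that unfolding cont_def eq by (auto simp: last_map split: prod.splits)
  qed
  have contE': "(cont n (D @ E))\<^sup>*\<^sup>* (length D + fst x, snd x) (length D + fst y, snd y)"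
    if "(cont n E)\<^sup>*\<^sup>* x y" for x y
    using that
  proof (induction rule: rtranclp_induct)
    case (step y z)
    then have "cont n (D @ E) (length D + fst y, snd y) (length D + fst z, snd z)"
      using contE by simp
    with step.IH show ?case by (rule rtranclp.rtrancl_into_rtrancl)
  qed simp
  have reachD: "\<exists>i < n. (cont n (D @ E))\<^sup>*\<^sup>* (0, i) (k, p)" if "k \<le> length D" "p < length (lev n D k)" for k p
    using that D contD mono_rtranclp[of "cont n D" "cont n (D @ E)"] unfolding valid_def by blast
  have "\<exists>i < n. (cont n (D @ E))\<^sup>*\<^sup>* (0, i) (k, p)"
    if kp: "k \<le> length (D @ E)" "p < length (lev n (D @ E) k)" for k p
  proof (cases "k \<le> length D")
    case True
    then show ?thesis using reachD kp by (simp add: lev_append)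
  next
    case False
    then obtain l where l: "k = length D + l" by (metis le_iff_add nat_le_linear)
    then have "l \<le> length E" "p < length (lev n E l)"
      using kp by (auto simp: shift)
    then obtain i where i: "i < n" "(cont n E)\<^sup>*\<^sup>* (0, i) (l, p)"
      using E unfolding valid_def by blast
    obtain i' where "i' < n" "(cont n (D @ E))\<^sup>*\<^sup>* (0, i') (length D, i)"
      using reachD[of "length D" i] i(1) by auto
    then show ?thesis
      using contE'[OF i(2)] l by (auto intro: rtranclp_trans)
  qed
  then show ?thesis
    using wf shift[of E "length E"] unfolding valid_def by simp
qed

lemma bb_matrix_append:
  assumes D: "valid n D" and E: "valid n E"
  shows "bb_matrix n (D @ E) = bb_matrix n D * bb_matrix n E"
proof -
  interpret D: string_link n D by unfold_locales (fact D)
  interpret E: string_link n E by unfold_locales (fact E)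
  interpret DE: string_link n "D @ E" by unfold_locales (rule valid_append[OF D E])
  have "bb_entry n (D @ E) i j = (\<Sum>k \<in> {0..<n}. bb_entry n D i k * bb_entry n E k j)"
    if ij: "i < n" "j < n" for i j
  proof -
    define g where "g = (\<lambda>k. if k < n then bb_entry n E k j else 0)"
    \<comment> \<open>Column \<open>j\<close> of the matrix product: the columns of \<open>D\<close>
      combined with the entries of column \<open>j\<close> of \<open>E\<close>.\<close>
    define f where "f = (\<lambda>p. \<Sum>k \<in> {0..<n}. g k * (if p < n then bb_entry n D p k else 0))"
    have "run (replicate n True) D f (\<lambda>p. \<Sum>k \<in> {0..<n}. g k * (if p = k then 1 else 0))"
      unfolding f_def by (rule run_sum) (auto intro: D.run_bb_entry)
    also have "(\<lambda>p. \<Sum>k \<in> {0..<n}. g k * (if p = k then 1 else 0)) = g"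
    proof
      fix p
      have "(\<Sum>k \<in> {0..<n}. g k * (if p = k then 1 else 0)) = (\<Sum>k \<in> {0..<n}. if p = k then g k else 0)"
        by (intro sum.cong) auto
      then show "(\<Sum>k \<in> {0..<n}. g k * (if p = k then 1 else 0)) = g p"
        by (simp add: g_def)
    qed
    \<comment> \<open>\<open>D\<close> carries \<open>f\<close> to \<open>g\<close>, and
      \<open>E\<close> carries \<open>g\<close> to the unit vector \<open>e_j\<close>; uniqueness
      for \<open>D @ E\<close> then identifies \<open>f\<close>.\<close>
    finally have "run (replicate n True) (D @ E) f (\<lambda>p. if p = j then 1 else 0)"
      using E.run_bb_entry[OF ij(2)] D.lev_bottom unfolding run_append g_def by (auto simp: lev_def)
    from DE.run_unique[OF DE.run_bb_entry[OF ij(2)] this ij(1)]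
    show ?thesis using ij by (simp add: f_def g_def mult.commute)
  qed
  then show ?thesis
    unfolding bb_matrix_def by (intro eq_matI) (auto simp: scalar_prod_def)
qed

lemma bb_matrix_Nil: "bb_matrix n [] = 1\<^sub>m n"
proof -
  have "valid n []" by (auto simp: valid_def)
  then interpret string_link n "[]" by unfold_locales
  \<comment> \<open>Over the empty word \<open>run\<close> is equality, so column \<open>j\<close>
    is the unit vector itself.\<close>
  have "bb_entry n [] i j = (if i = j then 1 else 0)" if "i < n" "j < n" for i j
    using fun_cong[OF run_bb_entry[OF that(2), unfolded run.simps], of i] that by simp
  then show ?thesis
    unfolding bb_matrix_def by (intro eq_matI) auto
qed

lemma bb_entry_form:
  assumes "valid n D"
  shows "\<exists>a b :: int. b \<in> {0, 1} \<and> bb_entry n D i j = of_int a * svar + of_int b"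
proof -
  interpret string_link n D by unfold_locales (fact assms)
  have of_int: "(of_int a :: dnum) = Dual a 0" for a
    by (induction a rule: int_induct[of _ 0]) (auto simp: dnum_eq_iff)
  have "bb_entry n D i j = of_int (ep (bb_entry n D i j)) * svar + of_int (re (bb_entry n D i j))"
    by (simp add: dnum_eq_iff of_int)
  moreover have "re (bb_entry n D i j) \<in> {0, 1}"
    unfolding bb_entry_eq by (rule re_h) simp
  ultimately show ?thesis by blast
qed

theorem theorem2p1:
  shows "(\<forall>n D i j. valid n D \<longrightarrow> i < n \<longrightarrow> j < n \<longrightarrow>
            (\<exists>a b :: int. b \<in> {0, 1} \<and> bb_entry n D i j = of_int a * svar + of_int b))
       \<and> (\<forall>n D D'. vsl_equiv n D D' \<longrightarrow> bb_matrix n D = bb_matrix n D')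
       \<and> (\<forall>n D1 D2. valid n D1 \<longrightarrow> valid n D2 \<longrightarrow>
            bb_matrix n (D1 @ D2) = bb_matrix n D1 * bb_matrix n D2)
       \<and> (\<forall>n. bb_matrix n [] = 1\<^sub>m n)"
proof (intro conjI allI impI)
  fix n D D'
  assume "vsl_equiv n D D'"
  then have "(rmove n)\<^sup>*\<^sup>* D D'" by (simp add: vsl_equiv_def)
  then show "bb_matrix n D = bb_matrix n D'"
    by (induction rule: rtranclp_induct) (auto dest: bb_matrix_rmove)
qed (use bb_entry_form bb_matrix_append bb_matrix_Nil in auto)

end
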